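(* Let $\triangle ABC$ be a triangle. For $P$ on the circumcircle of $\triangle ABC$, $P\ne A,B,C$, let $O^*$ be the center of the (degenerate) conic $\mathcal{Y}^*$ through the six vertices of the P-ellipses of $\triangle ABC$ with respect to $P$. Over all such $P$, the locus of $O^*$ is the union of arcs of three distinct ellipses $\mathcal{L}_a,\mathcal{L}_b,\mathcal{L}_c$, all of which pass through the three midpoints of the sides of $\triangle ABC$. The endpoints of the arc of $\mathcal{L}_a$ are one vertex of the V-ellipse $\mathcal{E}_b$ and one vertex of the V-ellipse $\mathcal{E}_c$, and so on cyclically for the endpoints of the arcs of $\mathcal{L}_b,\mathcal{L}_c$.
   Context: Given a triangle $\triangle ABC$ and a point $P$, the P-ellipses $\mathcal{E}_a^*,\mathcal{E}_b^*,\mathcal{E}_c^*$ are the ellipses with foci $(B,C)$, $(C,A)$, $(A,B)$, respectively, passing through $P$. The V-ellipses $\mathcal{E}_a,\mathcal{E}_b,\mathcal{E}_c$ are the ellipses with foci $(B,C)$, $(C,A)$, $(A,B)$ passing through $A,B,C$, respectively. The vertices of an ellipse are its two intersections with its focal axis (the line through the foci). The six vertices of the three P-ellipses always lie on a conic, denoted $\mathcal{Y}^*$; when $P$ is on the circumcircle it is a pair of lines, and its center is their intersection point. The arcs of $\mathcal{L}_a,\mathcal{L}_b,\mathcal{L}_c$ correspond to $P$ on the circumcircle arcs between $B$ and $C$, between $C$ and $A$, and between $A$ and $B$ (each arc not containing the third vertex), respectively; endpoints are limits as $P$ tends to the ends of these arcs. *)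

theory Defs
  imports "HOL-Analysis.Analysis"
begin

definition ellipse :: "real^2 \<Rightarrow> real^2 \<Rightarrow> real \<Rightarrow> (real^2) set" where
  "ellipse F G s = {X. dist X F + dist X G = s}"

text \<open>A circle counts as an ellipse with coinciding foci.\<close>

definition is_ellipse :: "(real^2) set \<Rightarrow> bool" where
  "is_ellipse E \<longleftrightarrow> (\<exists>F G s. dist F G < s \<and> E = ellipse F G s)"

definition ellipse_through :: "real^2 \<Rightarrow> real^2 \<Rightarrow> real^2 \<Rightarrow> (real^2) set" where
  "ellipse_through F G P = ellipse F G (dist P F + dist P G)"

text \<open>For distinct foci, the set of the two vertices on the focal axis.\<close>

definition focal_vertices :: "real^2 \<Rightarrow> real^2 \<Rightarrow> real^2 \<Rightarrow> (real^2) set" where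
  "focal_vertices F G P = ellipse_through F G P \<inter> affine hull {F, G}"

definition six_vertices :: "real^2 \<Rightarrow> real^2 \<Rightarrow> real^2 \<Rightarrow> real^2 \<Rightarrow> (real^2) set" where
  "six_vertices A B C P =
     focal_vertices B C P \<union> focal_vertices C A P \<union> focal_vertices A B P"

text \<open>Conics as zero sets of polynomials of degree exactly two; pairs of lines are included.\<close>

definition is_conic :: "(real^2) set \<Rightarrow> bool" where
  "is_conic Y \<longleftrightarrow> (\<exists>a b c d e f. (a, b, c) \<noteq> (0, 0, 0) \<and>
     Y = {X. a * (X$1)\<^sup>2 + b * X$1 * X$2 + c * (X$2)\<^sup>2 + d * X$1 + e * X$2 + f = 0})"

definition vertex_conic :: "real^2 \<Rightarrow> real^2 \<Rightarrow> real^2 \<Rightarrow> real^2 \<Rightarrow> (real^2) set" where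
  "vertex_conic A B C P = (THE Y. is_conic Y \<and> six_vertices A B C P \<subseteq> Y)"

definition is_line :: "(real^2) set \<Rightarrow> bool" where
  "is_line l \<longleftrightarrow> affine l \<and> aff_dim l = 1"

definition line_pair_center :: "(real^2) set \<Rightarrow> real^2" where
  "line_pair_center Y =
     (THE Z. \<exists>l m. is_line l \<and> is_line m \<and> Y = l \<union> m \<and> l \<inter> m = {Z})"

definition O_star :: "real^2 \<Rightarrow> real^2 \<Rightarrow> real^2 \<Rightarrow> real^2 \<Rightarrow> real^2" where
  "O_star A B C P = line_pair_center (vertex_conic A B C P)"

definition circumcircle :: "real^2 \<Rightarrow> real^2 \<Rightarrow> real^2 \<Rightarrow> (real^2) set" where
  "circumcircle A B C = (THE S. \<exists>z r. S = sphere z r \<and> {A, B, C} \<subseteq> S)"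

text \<open>The open arc of the circumcircle between \<open>B\<close> and \<open>C\<close> that does not contain \<open>A\<close>.\<close>

definition circum_arc :: "real^2 \<Rightarrow> real^2 \<Rightarrow> real^2 \<Rightarrow> (real^2) set" where
  "circum_arc A B C = (THE K. K \<in> components (circumcircle A B C - {B, C}) \<and> A \<notin> K)"

definition open_arc_image :: "(real \<Rightarrow> real^2) \<Rightarrow> (real^2) set" where
  "open_arc_image g = path_image g - {pathstart g, pathfinish g}"

text \<open>The point \<open>f P\<close> traces the arc \<open>g\<close> of the curve \<open>L\<close>, without its endpoints, while \<open>P\<close> runs
  through \<open>K\<close>; the endpoints of \<open>g\<close> are the limits of \<open>f P\<close> as \<open>P\<close> tends to the ends \<open>p\<close> and
  \<open>q\<close> of \<open>K\<close>.\<close>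

definition traces_arc ::
  "(real^2 \<Rightarrow> real^2) \<Rightarrow> (real^2) set \<Rightarrow> real^2 \<Rightarrow> real^2 \<Rightarrow> (real^2) set \<Rightarrow> (real \<Rightarrow> real^2) \<Rightarrow> bool" where
  "traces_arc f K p q L g \<longleftrightarrow>
     arc g \<and> path_image g \<subseteq> L \<and> f ` K = open_arc_image g \<and>
     (f \<longlongrightarrow> pathstart g) (at p within K) \<and> (f \<longlongrightarrow> pathfinish g) (at q within K)"

end

(* Idea. Let k_a = (PB + PC) / BC, and k_b, k_c cyclically. In barycentric coordinates (u : v : w)
   the six vertices lie on (u + v + w)^2 + 2 (p v w + q w u + r u v) = 0 with p = 2 / (k_a^2 - 1),
   q = 2 / (k_b^2 - 1), r = 2 / (k_c^2 - 1), and on no other conic. For P on the arc BC all chords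
   are sines of inscribed angles, the determinant of this form vanishes, and its kernel is O*.
   The barycentric coordinates of O* are then products of two sines of the position t of P, hence
   linear in cos 2t and sin 2t, so O* moves on an ellipse. Each midpoint arises from the t at which
   one coordinate vanishes. The three ellipses differ: at P = B the curve of the arc BC meets the
   line CA outside the segment CA, where the curve of the arc CA meets CA only inside it. *)

theory Submission
  imports Defs
begin

subsection \<open>Barycentric coordinates in the plane\<close>

text \<open>The formula for the center is free of absolute values and defines a curve for every real
  t, but it describes the center only for b < t < c, where the sines of all chords from P keep their
  sign. There u > 0 and v, w < 0, so no midpoint of a side lies on the arc itself; the midpoints
  have to be found at parameters beyond it. Half angles of the triangle and the position of P
  relative to the middle of the arc turn the trigonometry into polynomial identities modulo sin^2 +
  cos^2 = 1. The vanishing of the determinant comes with them: it says that the three center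
  coordinates have sum 1. One arc is enough: the parameter has period pi, and passing from (a, b, c)
  to (b, c, a + pi) renames the triangle cyclically. As P tends to B, the P-ellipse with foci C and
  A becomes the V-ellipse through B, while the center tends to a point of its axis CA; this is the
  origin of the endpoints. Conic, center, circumcircle and arc are all given by \<open>THE\<close>,
  so each of them also needs a uniqueness proof.\<close>

definition cross2 :: "real^2 \<Rightarrow> real^2 \<Rightarrow> real" where
  "cross2 x y = x$1 * y$2 - x$2 * y$1"

definition bary :: "real^2 \<Rightarrow> real^2 \<Rightarrow> real^2 \<Rightarrow> real \<Rightarrow> real \<Rightarrow> real \<Rightarrow> real^2" where
  "bary A B C u v w = u *\<^sub>R A + v *\<^sub>R B + w *\<^sub>R C"

lemma vec2_eq_iff: "(x::real^2) = y \<longleftrightarrow> x$1 = y$1 \<and> x$2 = y$2"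
  by (simp add: vec_eq_iff forall_2)

lemma cross2_eq_0_imp:
  assumes "cross2 x y = 0" "x \<noteq> 0" shows "\<exists>c. y = c *\<^sub>R x"
proof (cases "x$1 = 0")
  case True
  then have "x$2 \<noteq> 0" using assms(2) by (simp add: vec2_eq_iff)
  then show ?thesis using assms True
    by (intro exI[of _ "y$2 / x$2"]) (auto simp: vec2_eq_iff cross2_def)
next
  case False
  then show ?thesis using assms
    by (intro exI[of _ "y$1 / x$1"]) (auto simp: vec2_eq_iff cross2_def field_simps)
qed

lemma collinear_iff_cross2: "collinear {A, B, C} \<longleftrightarrow> cross2 (B - A) (C - A) = 0"
proof -
  have "collinear {A, B, C} \<longleftrightarrow> collinear {0, B - A, C - A}"
    using collinear_3[of B A C] by (simp add: insert_commute)
  also have "\<dots> \<longleftrightarrow> cross2 (B - A) (C - A) = 0"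
  proof -
    have "cross2 x (c *\<^sub>R x) = 0" "cross2 0 x = 0" "cross2 x 0 = 0" for x c
      by (simp_all add: cross2_def)
    then show ?thesis unfolding collinear_lemma using cross2_eq_0_imp by metis
  qed
  finally show ?thesis .
qed

text \<open>Cramer's rule in the plane.\<close>

lemma cross2_coords:
  assumes "cross2 e f \<noteq> 0"
  shows "X = (cross2 X f / cross2 e f) *\<^sub>R e + (cross2 e X / cross2 e f) *\<^sub>R f"
proof -
  have "cross2 X f * e$i + cross2 e X * f$i = X$i * cross2 e f" if "i = 1 \<or> i = 2" for i
    using that by (auto simp: cross2_def algebra_simps)
  then show ?thesis using assms
    by (simp add: vec2_eq_iff add_divide_distrib[symmetric])
qed

lemma cross2_indep:
  assumes "cross2 e f \<noteq> 0" "x *\<^sub>R e + y *\<^sub>R f = 0"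
  shows "x = 0 \<and> y = 0"
proof -
  have "cross2 (x *\<^sub>R e + y *\<^sub>R f) f = x * cross2 e f" "cross2 e (x *\<^sub>R e + y *\<^sub>R f) = y * cross2 e f"
    by (simp_all add: cross2_def algebra_simps)
  then show ?thesis using assms by (simp add: cross2_def)
qed

lemma bary_alt: "u + v + w = 1 \<Longrightarrow> bary A B C u v w = A + v *\<^sub>R (B - A) + w *\<^sub>R (C - A)"
proof -
  assume "u + v + w = 1"
  then have u: "u = 1 - v - w" by simp
  show ?thesis unfolding bary_def u by (simp add: algebra_simps)
qed

lemma bary_exists:
  assumes "\<not> collinear {A, B, C}"
  obtains u v w where "u + v + w = 1" "X = bary A B C u v w"
proof -
  have D: "cross2 (B - A) (C - A) \<noteq> 0" using assms by (simp add: collinear_iff_cross2)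
  obtain v w where "X - A = v *\<^sub>R (B - A) + w *\<^sub>R (C - A)" using cross2_coords[OF D] by blast
  then have "X = bary A B C (1 - v - w) v w"
    by (simp add: bary_alt) (metis add.assoc add_diff_cancel_left' diff_add_cancel add.commute)
  then show ?thesis using that[of "1 - v - w" v w] by simp
qed

lemma bary_unique:
  assumes "\<not> collinear {A, B, C}" "u + v + w = 1" "u' + v' + w' = 1"
    "bary A B C u v w = bary A B C u' v' w'"
  shows "u = u' \<and> v = v' \<and> w = w'"
proof -
  have D: "cross2 (B - A) (C - A) \<noteq> 0" using assms by (simp add: collinear_iff_cross2)
  have "(v - v') *\<^sub>R (B - A) + (w - w') *\<^sub>R (C - A) = 0"
    using assms(4) unfolding bary_alt[OF assms(2)] bary_alt[OF assms(3)] by (simp add: algebra_simps)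
  from cross2_indep[OF D this] show ?thesis using assms by simp
qed

subsection \<open>Ellipses from conjugate axes\<close>

text \<open>Principal axes: \<open>sin (2t) (f\<^sup>2 - e\<^sup>2) / 2 + cos (2t) (e \<bullet> f)\<close> changes sign between \<open>0\<close> and \<open>\<pi>/2\<close>.\<close>

lemma conjugate_axes_orthogonal:
  fixes e f :: "'a::real_inner"
  obtains t where "(cos t *\<^sub>R e + sin t *\<^sub>R f) \<bullet> (cos t *\<^sub>R f - sin t *\<^sub>R e) = 0"
    "norm (cos t *\<^sub>R f - sin t *\<^sub>R e) \<le> norm (cos t *\<^sub>R e + sin t *\<^sub>R f)"
proof -
  define g where "g t = (cos t *\<^sub>R e + sin t *\<^sub>R f) \<bullet> (cos t *\<^sub>R f - sin t *\<^sub>R e)" for t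
  have cont: "continuous_on {0..pi/2} g" unfolding g_def by (intro continuous_intros)
  have ends: "g 0 = e \<bullet> f" "g (pi/2) = - (e \<bullet> f)" by (simp_all add: g_def inner_commute)
  have "\<exists>t. 0 \<le> t \<and> t \<le> pi/2 \<and> g t = 0"
  proof (cases "e \<bullet> f \<le> 0")
    case True
    then show ?thesis using IVT'[of g 0 0 "pi/2"] cont ends by auto
  next
    case False
    then show ?thesis using IVT2'[of g "pi/2" 0 0] cont ends by auto
  qed
  then obtain t where t: "g t = 0" by blast
  show ?thesis
  proof (cases "norm (cos t *\<^sub>R f - sin t *\<^sub>R e) \<le> norm (cos t *\<^sub>R e + sin t *\<^sub>R f)")
    case True
    then show ?thesis using that[of t] t by (simp add: g_def)
  next
    case False
    have cs: "cos (t + pi/2) = - sin t" "sin (t + pi/2) = cos t" by (simp_all add: cos_add sin_add)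
    have "norm (- sin t *\<^sub>R f - cos t *\<^sub>R e) = norm (cos t *\<^sub>R e + sin t *\<^sub>R f)"
      by (subst norm_minus_cancel[symmetric]) (simp add: algebra_simps del: norm_minus_cancel)
    moreover have "(- sin t *\<^sub>R e + cos t *\<^sub>R f) \<bullet> (- sin t *\<^sub>R f - cos t *\<^sub>R e) = - g t"
      by (simp add: g_def inner_simps inner_commute algebra_simps)
    ultimately show ?thesis using that[of "t + pi/2"] t False cs by (simp add: add.commute)
  qed
qed

text \<open>The normalized ellipse has major semi-axis 1 and foci (k, 0) and (-k, 0). Measuring y in
  units of the minor semi-axis sqrt (1 - k^2) turns it into the unit circle, on which the focal
  distances are the linear expressions 1 - k x and 1 + k x.\<close>

lemma focal_sum_iff:
  fixes k x y :: real
  assumes "0 \<le> k" "k < 1"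
  shows "sqrt ((x - k)\<^sup>2 + (1 - k\<^sup>2) * y\<^sup>2) + sqrt ((x + k)\<^sup>2 + (1 - k\<^sup>2) * y\<^sup>2) = 2 \<longleftrightarrow> x\<^sup>2 + y\<^sup>2 = 1"
    (is "?l + ?r = 2 \<longleftrightarrow> _")
proof
  have k2: "k\<^sup>2 < 1" using assms by (simp add: power_less_one_iff)
  show "x\<^sup>2 + y\<^sup>2 = 1" if *: "?l + ?r = 2"
  proof -
    define l r where "l = ?l" and "r = ?r"
    have l: "l\<^sup>2 = (x - k)\<^sup>2 + (1 - k\<^sup>2) * y\<^sup>2" and r: "r\<^sup>2 = (x + k)\<^sup>2 + (1 - k\<^sup>2) * y\<^sup>2"
      using k2 by (auto simp: l_def r_def)
    have s: "r = 2 - l" using * by (simp add: l_def r_def)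
    \<comment> \<open>Subtracting the two squares leaves r^2 - l^2 = 4 k x, which is linear in l
      because r = 2 - l.\<close>
    from l r have "l = 1 - k * x" unfolding s by algebra
    then have "(1 - k * x)\<^sup>2 = (x - k)\<^sup>2 + (1 - k\<^sup>2) * y\<^sup>2" using l by simp
    then have "(1 - k\<^sup>2) * (x\<^sup>2 + y\<^sup>2 - 1) = 0" by (simp add: power2_eq_square algebra_simps)
    then show ?thesis using k2 by simp
  qed
  show "?l + ?r = 2" if *: "x\<^sup>2 + y\<^sup>2 = 1"
  proof -
    have "x\<^sup>2 \<le> 1" using * by (smt (verit) zero_le_power2)
    then have "\<bar>x\<bar> \<le> 1" by (simp add: abs_square_le_1)
    then have "\<bar>k * x\<bar> \<le> 1" using assms by (simp add: abs_mult mult_le_one)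
    moreover have "(x - k)\<^sup>2 + (1 - k\<^sup>2) * y\<^sup>2 = (1 - k * x)\<^sup>2" "(x + k)\<^sup>2 + (1 - k\<^sup>2) * y\<^sup>2 = (1 + k * x)\<^sup>2"
      using * by algebra+
    ultimately show ?thesis by (simp only: real_sqrt_abs)
  qed
qed

lemma is_ellipse_orthogonal_axes:
  assumes "cross2 e f \<noteq> 0" "e \<bullet> f = 0" "norm f \<le> norm e"
  shows "is_ellipse (range (\<lambda>t. c + cos t *\<^sub>R e + sin t *\<^sub>R f))"
proof -
  have ne: "norm e > 0" "norm f > 0" using assms(1) by (auto simp: cross2_def)
  \<comment> \<open>\<open>k\<close> is the eccentricity: the foci will be c + k e and c - k e, and
    the focal sum twice the norm of e.\<close>
  define k where "k = sqrt (1 - (norm f / norm e)\<^sup>2)"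
  have le1: "(norm f / norm e)\<^sup>2 \<le> 1" "(norm f / norm e)\<^sup>2 > 0"
    using ne assms(3) by (simp_all add: power_le_one)
  have k: "0 \<le> k" "k < 1" "k\<^sup>2 = 1 - (norm f / norm e)\<^sup>2"
    using le1 by (simp_all add: k_def)
  have "(norm f)\<^sup>2 = (1 - k\<^sup>2) * (norm e)\<^sup>2" using ne k(3) by (simp add: power_divide)
  then have ff: "f \<bullet> f = (1 - k\<^sup>2) * (norm e)\<^sup>2" by (simp add: dot_square_norm)
  have ee: "e \<bullet> e = (norm e)\<^sup>2" by (simp add: dot_square_norm)
  have nrm: "norm (x *\<^sub>R e + y *\<^sub>R f) = norm e * sqrt (x\<^sup>2 + (1 - k\<^sup>2) * y\<^sup>2)" for x y
  proof -
    have "(x *\<^sub>R e + y *\<^sub>R f) \<bullet> (x *\<^sub>R e + y *\<^sub>R f) = (norm e)\<^sup>2 * (x\<^sup>2 + (1 - k\<^sup>2) * y\<^sup>2)"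
      using assms(2) by (simp add: inner_add_left inner_add_right inner_commute[of f e] ff ee power2_eq_square algebra_simps)
    then show ?thesis using ne by (simp add: norm_eq_sqrt_inner real_sqrt_mult)
  qed
  have *: "dist (c + x *\<^sub>R e + y *\<^sub>R f) (c + k *\<^sub>R e) + dist (c + x *\<^sub>R e + y *\<^sub>R f) (c - k *\<^sub>R e) = 2 * norm e
      \<longleftrightarrow> x\<^sup>2 + y\<^sup>2 = 1" for x y
  proof -
    have d: "dist (c + x *\<^sub>R e + y *\<^sub>R f) (c + k *\<^sub>R e) = norm ((x - k) *\<^sub>R e + y *\<^sub>R f)"
      "dist (c + x *\<^sub>R e + y *\<^sub>R f) (c - k *\<^sub>R e) = norm ((x + k) *\<^sub>R e + y *\<^sub>R f)"
      by (simp_all add: dist_norm algebra_simps)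
    have "dist (c + x *\<^sub>R e + y *\<^sub>R f) (c + k *\<^sub>R e) + dist (c + x *\<^sub>R e + y *\<^sub>R f) (c - k *\<^sub>R e)
      = norm e * (sqrt ((x - k)\<^sup>2 + (1 - k\<^sup>2) * y\<^sup>2) + sqrt ((x + k)\<^sup>2 + (1 - k\<^sup>2) * y\<^sup>2))"
      unfolding d nrm by (simp add: distrib_left)
    then show ?thesis using ne focal_sum_iff[OF k(1,2), of x y] by auto
  qed
  have "range (\<lambda>t. c + cos t *\<^sub>R e + sin t *\<^sub>R f) = ellipse (c + k *\<^sub>R e) (c - k *\<^sub>R e) (2 * norm e)"
  proof (intro set_eqI iffI)
    fix X assume "X \<in> range (\<lambda>t. c + cos t *\<^sub>R e + sin t *\<^sub>R f)"
    then show "X \<in> ellipse (c + k *\<^sub>R e) (c - k *\<^sub>R e) (2 * norm e)"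
      using * by (auto simp: ellipse_def)
  next
    fix X assume X: "X \<in> ellipse (c + k *\<^sub>R e) (c - k *\<^sub>R e) (2 * norm e)"
    obtain x y where "X - c = x *\<^sub>R e + y *\<^sub>R f" using cross2_coords[OF assms(1)] by blast
    then have Xxy: "X = c + x *\<^sub>R e + y *\<^sub>R f" by (simp add: algebra_simps)
    with X * have "x\<^sup>2 + y\<^sup>2 = 1" by (auto simp: ellipse_def)
    then obtain t where "x = cos t" "y = sin t" using sincos_total_2pi by metis
    then show "X \<in> range (\<lambda>t. c + cos t *\<^sub>R e + sin t *\<^sub>R f)" using Xxy by auto
  qed
  moreover have "dist (c + k *\<^sub>R e) (c - k *\<^sub>R e) < 2 * norm e"
  proof -
    have "c + k *\<^sub>R e - (c - k *\<^sub>R e) = (2 * k) *\<^sub>R e" by (simp add: vec2_eq_iff)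
    then show ?thesis using k ne by (simp add: dist_norm)
  qed
  ultimately show ?thesis unfolding is_ellipse_def by blast
qed

text \<open>Shifting the angle replaces e, f by another pair of conjugate semi-diameters and
  preserves both the curve and the determinant; the orthogonal pair among them gives the principal
  axes.\<close>

lemma is_ellipse_range:
  assumes "cross2 e f \<noteq> 0"
  shows "is_ellipse (range (\<lambda>t. c + cos t *\<^sub>R e + sin t *\<^sub>R f))"
proof -
  obtain t where t: "(cos t *\<^sub>R e + sin t *\<^sub>R f) \<bullet> (cos t *\<^sub>R f - sin t *\<^sub>R e) = 0"
    "norm (cos t *\<^sub>R f - sin t *\<^sub>R e) \<le> norm (cos t *\<^sub>R e + sin t *\<^sub>R f)"
    by (rule conjugate_axes_orthogonal)
  let ?e = "cos t *\<^sub>R e + sin t *\<^sub>R f" and ?f = "cos t *\<^sub>R f - sin t *\<^sub>R e"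
  have "cross2 ?e ?f = ((cos t)\<^sup>2 + (sin t)\<^sup>2) * cross2 e f"
    unfolding cross2_def by (simp del: sin_cos_squared_add sin_cos_squared_add2) algebra
  then have "cross2 ?e ?f \<noteq> 0" using assms by simp
  from is_ellipse_orthogonal_axes[OF this t]
  have "is_ellipse (range (\<lambda>s. c + cos s *\<^sub>R ?e + sin s *\<^sub>R ?f))" .
  moreover have "c + cos s *\<^sub>R ?e + sin s *\<^sub>R ?f = c + cos (s + t) *\<^sub>R e + sin (s + t) *\<^sub>R f" for s
    by (simp add: cos_add sin_add algebra_simps)
  moreover have "range (\<lambda>s. c + cos (s + t) *\<^sub>R e + sin (s + t) *\<^sub>R f) = range (\<lambda>s. c + cos s *\<^sub>R e + sin s *\<^sub>R f)"
    (is "range (\<lambda>s. ?h (s + t)) = _")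
  proof -
    have "?h s \<in> range (\<lambda>s. ?h (s + t))" for s by (rule range_eqI[of _ _ "s - t"]) simp
    then show ?thesis by blast
  qed
  ultimately show ?thesis by simp
qed

subsection \<open>The conic through the six vertices\<close>

text \<open>The 1 is (u + v + w)^2 in normalized coordinates. On the line u = 0 the equation becomes
  1 + 2 p v w = 0, so each of p, q, r governs the two vertices on one side.\<close>

definition bary_conic :: "real^2 \<Rightarrow> real^2 \<Rightarrow> real^2 \<Rightarrow> real \<Rightarrow> real \<Rightarrow> real \<Rightarrow> (real^2) set" where
  "bary_conic A B C p q r = {bary A B C u v w | u v w.
     u + v + w = 1 \<and> 1 + 2 * (p * v * w + q * w * u + r * u * v) = 0}"

lemma bary_in_bary_conic:
  assumes "\<not> collinear {A, B, C}" "u + v + w = 1"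
  shows "bary A B C u v w \<in> bary_conic A B C p q r \<longleftrightarrow> 1 + 2 * (p * v * w + q * w * u + r * u * v) = 0"
  using bary_unique[OF assms(1,2)] assms(2) unfolding bary_conic_def by blast

lemma is_conic_bary_conic:
  assumes nc: "\<not> collinear {A, B, C}" and r: "r \<noteq> 0"
  shows "is_conic (bary_conic A B C p q r)"
proof -
  define D where "D = cross2 (B - A) (C - A)"
  have D: "D \<noteq> 0" using nc by (simp add: collinear_iff_cross2 D_def)
  define v1 v2 w1 w2 where "v1 = (C - A)$2 / D" "v2 = - (C - A)$1 / D"
    "w1 = - (B - A)$2 / D" "w2 = (B - A)$1 / D"
  define v0 w0 where "v0 = - (v1 * A$1 + v2 * A$2)" "w0 = - (w1 * A$1 + w2 * A$2)"
  define v w where "v X = v0 + v1 * X$1 + v2 * X$2" "w X = w0 + w1 * X$1 + w2 * X$2" for X :: "real^2"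
  have X: "X = bary A B C (1 - v X - w X) (v X) (w X)" for X
  proof -
    have "v X = cross2 (X - A) (C - A) / D" "w X = cross2 (B - A) (X - A) / D"
      by (simp_all add: v_w_def v0_w0_def v1_v2_w1_w2_def cross2_def diff_divide_distrib add_divide_distrib algebra_simps)
    then have "X - A = v X *\<^sub>R (B - A) + w X *\<^sub>R (C - A)"
      using cross2_coords D unfolding D_def by metis
    then show ?thesis by (simp add: bary_alt algebra_simps)
  qed
  define m where "m = p - q - r"
  define a b c where "a = 2 * (m * v1 * w1 - q * w1\<^sup>2 - r * v1\<^sup>2)"
    "b = 2 * (m * (v1 * w2 + v2 * w1) - 2 * q * w1 * w2 - 2 * r * v1 * v2)"
    "c = 2 * (m * v2 * w2 - q * w2\<^sup>2 - r * v2\<^sup>2)"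
  define d e f where "d = 2 * (q * w1 + r * v1 + m * (v0 * w1 + v1 * w0) - 2 * q * w0 * w1 - 2 * r * v0 * v1)"
    "e = 2 * (q * w2 + r * v2 + m * (v0 * w2 + v2 * w0) - 2 * q * w0 * w2 - 2 * r * v0 * v2)"
    "f = 1 + 2 * (q * w0 + r * v0 + m * v0 * w0 - q * w0\<^sup>2 - r * v0\<^sup>2)"
  have *: "1 + 2 * (p * v X * w X + q * w X * (1 - v X - w X) + r * (1 - v X - w X) * v X) =
      a * (X$1)\<^sup>2 + b * X$1 * X$2 + c * (X$2)\<^sup>2 + d * X$1 + e * X$2 + f" for X
    unfolding v_w_def a_b_c_def d_e_f_def m_def by algebra
  have "(a, b, c) \<noteq> (0, 0, 0)"
  proof
    assume abc: "(a, b, c) = (0, 0, 0)"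
    \<comment> \<open>The quadratic part is tested in the direction B - A: along it v grows by 1 and
      w is constant, which leaves only -2 r.\<close>
    define x y where "x = (B - A)$1" "y = (B - A)$2"
    have "v1 * x + v2 * y = 1" "w1 * x + w2 * y = 0"
      using D unfolding v1_v2_w1_w2_def x_y_def
      by (simp_all add: divide_simps) (simp_all add: D_def cross2_def algebra_simps)
    moreover have "a * x\<^sup>2 + b * x * y + c * y\<^sup>2 = 2 * (m * (v1 * x + v2 * y) * (w1 * x + w2 * y)
        - q * (w1 * x + w2 * y)\<^sup>2 - r * (v1 * x + v2 * y)\<^sup>2)"
      unfolding a_b_c_def by algebra
    ultimately show False using abc r by simp
  qed
  moreover have "bary_conic A B C p q r =
      {X. a * (X$1)\<^sup>2 + b * X$1 * X$2 + c * (X$2)\<^sup>2 + d * X$1 + e * X$2 + f = 0}"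
  proof (intro set_eqI)
    fix X
    show "X \<in> bary_conic A B C p q r \<longleftrightarrow>
        X \<in> {X. a * (X$1)\<^sup>2 + b * X$1 * X$2 + c * (X$2)\<^sup>2 + d * X$1 + e * X$2 + f = 0}"
      using bary_in_bary_conic[OF nc, of "1 - v X - w X" "v X" "w X" p q r] *[of X] X[of X, symmetric] by simp
  qed
  ultimately show ?thesis unfolding is_conic_def by blast
qed

text \<open>Since u + v + w = 1, the linear and constant terms can be made homogeneous of degree
  two. \<open>K\<close> is twice the polarization of \<open>F\<close>, so its values at pairs of
  vertices are the mixed coefficients.\<close>

lemma quadratic_bary:
  fixes a b c d e f :: real
  defines "F \<equiv> \<lambda>X::real^2. a * (X$1)\<^sup>2 + b * X$1 * X$2 + c * (X$2)\<^sup>2 + d * X$1 + e * X$2 + f"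
  obtains k1 k2 k3 where "\<And>u v w. u + v + w = 1 \<Longrightarrow>
    F (bary A B C u v w) = F A * u\<^sup>2 + F B * v\<^sup>2 + F C * w\<^sup>2 + k1 * v * w + k2 * w * u + k3 * u * v"
proof -
  define K where "K X Y = 2 * a * X$1 * Y$1 + b * (X$1 * Y$2 + X$2 * Y$1) + 2 * c * X$2 * Y$2
      + d * (X$1 + Y$1) + e * (X$2 + Y$2) + 2 * f" for X Y :: "real^2"
  have "F (bary A B C u v w) = F A * u\<^sup>2 + F B * v\<^sup>2 + F C * w\<^sup>2 + K B C * v * w + K C A * w * u + K A B * u * v"
    if "u + v + w = 1" for u v w
  proof -
    have u: "u = 1 - v - w" using that by simp
    show ?thesis unfolding F_def K_def bary_def u by (simp add: vector_add_component) algebra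
  qed
  then show ?thesis by (rule that)
qed

text \<open>The two vertices on a side are symmetric about its midpoint: this forces the coefficients of a
  conic through them at the two ends to be equal.\<close>

lemma quadratic_form_symmetric_roots:
  fixes F G k p v w :: real
  assumes "p > 0" "v + w = 1" "1 + 2 * (p * v * w) = 0"
    "F * v\<^sup>2 + G * w\<^sup>2 + k * v * w = 0" "F * w\<^sup>2 + G * v\<^sup>2 + k * w * v = 0"
  shows "F = G \<and> k = 2 * F * (p + 1)"
proof -
  have "v * w \<noteq> 0" using assms(3) by auto
  have "v \<noteq> w"
  proof
    assume "v = w"
    then have "1 + 2 * (p * v\<^sup>2) = 0" using assms(3) by (simp add: power2_eq_square)
    moreover have "0 \<le> p * v\<^sup>2" using assms(1) by simp
    ultimately show False by linarith
  qed
  have "(F - G) * (v - w) * (v + w) = 0" using assms(4,5) by algebra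
  then have FG: "F = G" using assms(2) \<open>v \<noteq> w\<close> by simp
  have "(k - 2 * F * (p + 1)) * (v * w) = 0" using assms(2-4) unfolding FG by algebra
  then show ?thesis using FG \<open>v * w \<noteq> 0\<close> by simp
qed

text \<open>Each side forces equal values of the polynomial at its two ends and fixes one mixed
  coefficient. Around the triangle this makes the polynomial a multiple of the form in
  \<open>bary_conic\<close>. The factor is its value at A; if that were 0, the polynomial would
  vanish on the whole plane.\<close>

lemma bary_conic_unique:
  assumes nc: "\<not> collinear {A, B, C}" and p: "p > 0" "q > 0" "r > 0"
    and Y: "is_conic Y"
    and S: "{v *\<^sub>R B + w *\<^sub>R C | v w. v + w = 1 \<and> 1 + 2 * (p * v * w) = 0} \<subseteq> Y"
      "{v *\<^sub>R C + w *\<^sub>R A | v w. v + w = 1 \<and> 1 + 2 * (q * v * w) = 0} \<subseteq> Y"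
      "{v *\<^sub>R A + w *\<^sub>R B | v w. v + w = 1 \<and> 1 + 2 * (r * v * w) = 0} \<subseteq> Y"
  shows "Y = bary_conic A B C p q r"
proof -
  obtain a b c d e f where abc: "(a, b, c) \<noteq> (0, 0, 0)"
    and Yeq: "Y = {X. a * (X$1)\<^sup>2 + b * X$1 * X$2 + c * (X$2)\<^sup>2 + d * X$1 + e * X$2 + f = 0}"
    using Y unfolding is_conic_def by blast
  define F where "F X = a * (X$1)\<^sup>2 + b * X$1 * X$2 + c * (X$2)\<^sup>2 + d * X$1 + e * X$2 + f" for X :: "real^2"
  have Yeq: "Y = {X. F X = 0}" by (simp add: Yeq F_def)
  obtain k1 k2 k3 where K: "\<And>u v w. u + v + w = 1 \<Longrightarrow>
    F (bary A B C u v w) = F A * u\<^sup>2 + F B * v\<^sup>2 + F C * w\<^sup>2 + k1 * v * w + k2 * w * u + k3 * u * v"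
    using quadratic_bary[where a=a and b=b and c=c and d=d and e=e and f=f and A=A and B=B and C=C] unfolding F_def by metis
  have roots: "\<exists>v w. v + w = 1 \<and> 1 + 2 * (s * v * w) = 0 \<and> 1 + 2 * (s * w * v) = 0" if "s > 0" for s :: real
  proof -
    \<comment> \<open>For s = 2 / (k^2 - 1) this is t = k: the two vertices lie k / 2 side lengths
      away from the midpoint.\<close>
    define t where "t = sqrt (1 + 2 / s)"
    have "t\<^sup>2 = 1 + 2 / s" using that by (simp add: t_def)
    then have "s * t\<^sup>2 = s + 2" using that by (simp add: field_simps)
    then show ?thesis
      by (intro exI[of _ "(1 + t) / 2"] exI[of _ "(1 - t) / 2"]) (auto simp: field_simps power2_eq_square)
  qed
  have 1: "F B = F C \<and> k1 = 2 * F B * (p + 1)"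
  proof -
    obtain v w where vw: "v + w = 1" "1 + 2 * (p * v * w) = 0" "1 + 2 * (p * w * v) = 0" using roots p by blast
    have "v *\<^sub>R B + w *\<^sub>R C \<in> Y"
      using vw by (intro S(1)[THEN subsetD] CollectI exI[of _ v] exI[of _ w]) simp
    moreover have "w *\<^sub>R B + v *\<^sub>R C \<in> Y"
      using vw by (intro S(1)[THEN subsetD] CollectI exI[of _ w] exI[of _ v]) simp
    ultimately show ?thesis
      using quadratic_form_symmetric_roots[OF p(1) vw(1,2)] K[of 0 v w] K[of 0 w v] vw(1)
      by (auto simp: bary_def Yeq add.commute)
  qed
  have 2: "F C = F A \<and> k2 = 2 * F C * (q + 1)"
  proof -
    obtain v w where vw: "v + w = 1" "1 + 2 * (q * v * w) = 0" "1 + 2 * (q * w * v) = 0" using roots p by blast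
    have "v *\<^sub>R C + w *\<^sub>R A \<in> Y"
      using vw by (intro S(2)[THEN subsetD] CollectI exI[of _ v] exI[of _ w]) simp
    moreover have "w *\<^sub>R C + v *\<^sub>R A \<in> Y"
      using vw by (intro S(2)[THEN subsetD] CollectI exI[of _ w] exI[of _ v]) simp
    ultimately show ?thesis
      using quadratic_form_symmetric_roots[OF p(2) vw(1,2)] K[of w 0 v] K[of v 0 w] vw(1)
      by (auto simp: bary_def Yeq add.commute)
  qed
  have 3: "k3 = 2 * F A * (r + 1)"
  proof -
    obtain v w where vw: "v + w = 1" "1 + 2 * (r * v * w) = 0" "1 + 2 * (r * w * v) = 0" using roots p by blast
    have "v *\<^sub>R A + w *\<^sub>R B \<in> Y"
      using vw by (intro S(3)[THEN subsetD] CollectI exI[of _ v] exI[of _ w]) simp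
    moreover have "w *\<^sub>R A + v *\<^sub>R B \<in> Y"
      using vw by (intro S(3)[THEN subsetD] CollectI exI[of _ w] exI[of _ v]) simp
    ultimately show ?thesis
      using quadratic_form_symmetric_roots[OF p(3) vw(1,2), of "F A" "F B" k3] K[of v w 0] K[of w v 0] vw(1)
      by (auto simp: bary_def Yeq add.commute)
  qed
  have F: "F (bary A B C u v w) = F A * (1 + 2 * (p * v * w + q * w * u + r * u * v))" if "u + v + w = 1" for u v w
  proof -
    have u: "u = 1 - v - w" using that by simp
    have "F (bary A B C u v w) = F A * u\<^sup>2 + F A * v\<^sup>2 + F A * w\<^sup>2 + 2 * F A * (p + 1) * v * w
        + 2 * F A * (q + 1) * w * u + 2 * F A * (r + 1) * u * v"
      using K[OF that] 1 2 3 by simp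
    then show ?thesis unfolding u by algebra
  qed
  have "F A \<noteq> 0"
  proof
    assume "F A = 0"
    then have 0: "F X = 0" for X using bary_exists[OF nc, of X] F by (metis mult_zero_left)
    have "a * x\<^sup>2 + b * x * y + c * y\<^sup>2 + d * x + e * y + f = 0" for x y
      using 0[of "vector [x, y]"] by (simp add: F_def)
    \<comment> \<open>The values at these six points determine all six coefficients.\<close>
    from this[of 0 0] this[of 1 0] this[of "-1" 0] this[of 0 1] this[of 0 "-1"] this[of 1 1] abc
    show False by auto
  qed
  show ?thesis
  proof (intro set_eqI)
    fix X
    obtain u v w where X: "u + v + w = 1" "X = bary A B C u v w" using bary_exists[OF nc] .
    show "X \<in> Y \<longleftrightarrow> X \<in> bary_conic A B C p q r"
      using F[OF X(1)] \<open>F A \<noteq> 0\<close> bary_in_bary_conic[OF nc X(1)] by (simp add: X(2) Yeq)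
  qed
qed

text \<open>\<open>k\<close> is the major axis divided by the focal distance. A point of the axis
  has focal distances |w| and |v| times BC. As |v| + |w| = k > 1 = v + w, the coordinates have
  opposite signs, hence |v - w| = k and 4 v w = 1 - k^2.\<close>

lemma focal_vertices_eq:
  assumes "B \<noteq> C" "dist P B + dist P C = k * dist B C" "k > 1"
  shows "focal_vertices B C P = {v *\<^sub>R B + w *\<^sub>R C | v w. v + w = 1 \<and> 1 + 2 * (2 / (k\<^sup>2 - 1) * v * w) = 0}"
proof -
  have k2: "k\<^sup>2 - 1 > 0" using assms(3) by (simp add: one_less_power)
  have "v *\<^sub>R B + w *\<^sub>R C \<in> ellipse_through B C P \<longleftrightarrow> 1 + 2 * (2 / (k\<^sup>2 - 1) * v * w) = 0" if "v + w = 1" for v w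
  proof -
    have v: "v = 1 - w" using that by simp
    have "v *\<^sub>R B + w *\<^sub>R C - B = w *\<^sub>R (C - B)" "v *\<^sub>R B + w *\<^sub>R C - C = v *\<^sub>R (B - C)"
      unfolding v by (simp_all add: algebra_simps)
    then have "dist (v *\<^sub>R B + w *\<^sub>R C) B = \<bar>w\<bar> * dist B C" "dist (v *\<^sub>R B + w *\<^sub>R C) C = \<bar>v\<bar> * dist B C"
      by (simp_all add: dist_norm norm_minus_commute)
    then have "v *\<^sub>R B + w *\<^sub>R C \<in> ellipse_through B C P \<longleftrightarrow> (\<bar>w\<bar> + \<bar>v\<bar>) * dist B C = k * dist B C"
      by (simp add: ellipse_through_def ellipse_def assms(2) distrib_right)
    also have "\<dots> \<longleftrightarrow> \<bar>w\<bar> + \<bar>v\<bar> = k" using assms(1) by simp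
    also have "\<dots> \<longleftrightarrow> v * w = (1 - k\<^sup>2) / 4"
    proof (cases "v * w \<ge> 0")
      case True
      then have "\<bar>w\<bar> + \<bar>v\<bar> = 1" using that by (auto simp: zero_le_mult_iff)
      moreover have "v * w \<noteq> (1 - k\<^sup>2) / 4" using True k2 by auto
      ultimately show ?thesis using assms(3) by auto
    next
      case False
      then have "\<bar>w\<bar> + \<bar>v\<bar> = \<bar>v - w\<bar>" by (auto simp: mult_le_0_iff zero_le_mult_iff)
      also have "\<dots> = k \<longleftrightarrow> (v - w)\<^sup>2 = k\<^sup>2" using assms(3) by (metis abs_of_pos less_trans power2_eq_iff zero_less_one abs_eq_iff)
      also have "(v - w)\<^sup>2 = 1 - 4 * (v * w)" unfolding v by algebra
      finally show ?thesis by auto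
    qed
    also have "\<dots> \<longleftrightarrow> 1 + 2 * (2 / (k\<^sup>2 - 1) * v * w) = 0" using k2 by (auto simp: field_simps)
    finally show ?thesis .
  qed
  then show ?thesis unfolding focal_vertices_def affine_hull_2 by blast
qed

lemma vertex_conic_eq:
  assumes nc: "\<not> collinear {A, B, C}"
    and k: "dist P B + dist P C = ka * dist B C" "ka > 1"
      "dist P C + dist P A = kb * dist C A" "kb > 1"
      "dist P A + dist P B = kc * dist A B" "kc > 1"
  shows "vertex_conic A B C P = bary_conic A B C (2 / (ka\<^sup>2 - 1)) (2 / (kb\<^sup>2 - 1)) (2 / (kc\<^sup>2 - 1))"
    (is "_ = bary_conic A B C ?p ?q ?r")
proof -
  have ne: "A \<noteq> B" "B \<noteq> C" "C \<noteq> A" using nc by (auto simp: insert_commute)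
  have pos: "?p > 0" "?q > 0" "?r > 0" using k by (simp_all add: one_less_power)
  note fv = focal_vertices_eq[OF ne(2) k(1,2)] focal_vertices_eq[OF ne(3) k(3,4)] focal_vertices_eq[OF ne(1) k(5,6)]
  have sub: "six_vertices A B C P \<subseteq> bary_conic A B C ?p ?q ?r"
  proof -
    have "v *\<^sub>R B + w *\<^sub>R C \<in> bary_conic A B C ?p ?q ?r"
      if "v + w = 1" "1 + 2 * (?p * v * w) = 0" for v w
      using bary_in_bary_conic[OF nc, of 0 v w ?p ?q ?r] that by (simp add: bary_def)
    moreover have "v *\<^sub>R C + w *\<^sub>R A \<in> bary_conic A B C ?p ?q ?r"
      if "v + w = 1" "1 + 2 * (?q * v * w) = 0" for v w
      using bary_in_bary_conic[OF nc, of w 0 v ?p ?q ?r] that by (simp add: bary_def add.commute[of "w *\<^sub>R A"])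
    moreover have "v *\<^sub>R A + w *\<^sub>R B \<in> bary_conic A B C ?p ?q ?r"
      if "v + w = 1" "1 + 2 * (?r * v * w) = 0" for v w
      using bary_in_bary_conic[OF nc, of v w 0 ?p ?q ?r] that by (simp add: bary_def)
    ultimately show ?thesis unfolding six_vertices_def fv by blast
  qed
  have conic: "is_conic (bary_conic A B C ?p ?q ?r)" using is_conic_bary_conic[OF nc] pos by simp
  have unique: "Y = bary_conic A B C ?p ?q ?r" if "is_conic Y" "six_vertices A B C P \<subseteq> Y" for Y
    using that(2)[unfolded six_vertices_def fv Un_subset_iff]
    by (intro bary_conic_unique[OF nc pos that(1)]) (elim conjE, assumption)+
  show ?thesis unfolding vertex_conic_def
    by (rule the_equality, rule conjI[OF conic sub], elim conjE, rule unique)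
qed

subsection \<open>Centers of line pairs\<close>

lemma is_line_through:
  assumes "is_line l" "x \<in> l" "y \<in> l" "x \<noteq> y"
  shows "l = affine hull {x, y}"
proof -
  have "affine hull {x, y} = l"
    using assms by (intro affine_dim_equal) (auto simp: is_line_def hull_minimal aff_dim_2)
  then show ?thesis ..
qed

lemma is_line_range:
  assumes "d \<noteq> 0" shows "is_line (range (\<lambda>t. Z + t *\<^sub>R d))"
proof -
  have "range (\<lambda>t. Z + t *\<^sub>R d) = affine hull {Z, Z + d}"
    unfolding affine_hull_2_alt by auto
  then show ?thesis using assms by (simp add: is_line_def aff_dim_2)
qed

lemma is_line_obtains:
  assumes "is_line l"
  obtains Z d where "d \<noteq> 0" "l = range (\<lambda>t. Z + t *\<^sub>R d)"
proof -
  have "l \<noteq> {}" "\<nexists>x. l = {x}" using assms by (auto simp: is_line_def)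
  then obtain x y where "x \<in> l" "y \<in> l" "x \<noteq> y" by blast
  then have "l = range (\<lambda>t. x + t *\<^sub>R (y - x))"
    using is_line_through[OF assms] unfolding affine_hull_2_alt by blast
  then show ?thesis using that[of "y - x" x] \<open>x \<noteq> y\<close> by simp
qed

text \<open>Pigeonhole: of three points on n, two lie on the same one of l and m, and two points
  determine a line.\<close>

lemma is_line_subset_union:
  assumes "is_line n" "is_line l" "is_line m" "n \<subseteq> l \<union> m"
  shows "n = l \<or> n = m"
proof -
  obtain Z d where d: "d \<noteq> 0" "n = range (\<lambda>t. Z + t *\<^sub>R d)" by (rule is_line_obtains[OF assms(1)])
  define x where "x i = Z + real i *\<^sub>R d" for i
  have x: "x i \<in> n" "x i \<in> l \<or> x i \<in> m" for i using d assms(4) by (auto simp: x_def)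
  have ne: "x i \<noteq> x j" if "i \<noteq> j" for i j using that d by (simp add: x_def)
  obtain i j where ij: "i \<noteq> j" "x i \<in> l \<and> x j \<in> l \<or> x i \<in> m \<and> x j \<in> m"
  proof -
    define S where "S i j \<longleftrightarrow> x i \<in> l \<and> x j \<in> l \<or> x i \<in> m \<and> x j \<in> m" for i j
    have "S 0 1 \<or> S 0 2 \<or> S 1 2" using x(2)[of 0] x(2)[of 1] x(2)[of 2] unfolding S_def by blast
    moreover have "(0::nat) \<noteq> 1" "(0::nat) \<noteq> 2" "(1::nat) \<noteq> 2" by simp_all
    ultimately show ?thesis using that unfolding S_def by blast
  qed
  have n: "n = affine hull {x i, x j}" using is_line_through[OF assms(1) x(1) x(1) ne[OF ij(1)]] .
  from ij(2) show ?thesis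
    using is_line_through[OF assms(2) _ _ ne[OF ij(1)]] is_line_through[OF assms(3) _ _ ne[OF ij(1)]] n by auto
qed

text \<open>The union determines the two lines up to order, so any other decomposition has the same
  crossing point.\<close>

lemma line_pair_center_eq:
  assumes "is_line l" "is_line m" "l \<inter> m = {Z}"
  shows "line_pair_center (l \<union> m) = Z"
  unfolding line_pair_center_def
proof (rule the_equality)
  show "\<exists>l' m'. is_line l' \<and> is_line m' \<and> l \<union> m = l' \<union> m' \<and> l' \<inter> m' = {Z}" using assms by blast
next
  fix Z' assume "\<exists>l' m'. is_line l' \<and> is_line m' \<and> l \<union> m = l' \<union> m' \<and> l' \<inter> m' = {Z'}"
  then obtain l' m' where *: "is_line l'" "is_line m'" "l \<union> m = l' \<union> m'" "l' \<inter> m' = {Z'}" by blast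
  have "l' = l \<or> l' = m" "m' = l \<or> m' = m"
    using is_line_subset_union[OF *(1) assms(1,2)] is_line_subset_union[OF *(2) assms(1,2)] *(3) by blast+
  \<comment> \<open>Equal lines would meet in a whole line instead of a single point.\<close>
  moreover have "l' \<noteq> m'" using * by (auto simp: is_line_def)
  ultimately have "l' \<inter> m' = l \<inter> m" by blast
  then show "Z' = Z" using * assms by simp
qed

text \<open>\<open>deg\<close> is the vanishing of the determinant of the form, and the point on the
  right is its kernel scaled to coordinate sum 1. Seen from this point the equation is a binary
  quadratic form with discriminant (p - q - r)^2 - 4 q r, up to a positive factor. By
  \<open>deg\<close> this is 2 p q r > 0, so the conic splits into two distinct real lines.\<close>

lemma line_pair_center_bary_conic:
  assumes nc: "\<not> collinear {A, B, C}" and p: "p > 0" "q > 0" "r > 0"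
    and deg: "p\<^sup>2 + q\<^sup>2 + r\<^sup>2 - 2 * p * q - 2 * q * r - 2 * r * p = 2 * p * q * r"
  shows "line_pair_center (bary_conic A B C p q r) =
    bary A B C ((p - q - r) / (2 * q * r)) ((q - r - p) / (2 * r * p)) ((r - p - q) / (2 * p * q))"
    (is "_ = bary A B C ?u ?v ?w")
proof -
  define Z where "Z = bary A B C ?u ?v ?w"
  have "?u + ?v + ?w = (p * (p - q - r) + q * (q - r - p) + r * (r - p - q)) / (2 * p * q * r)"
    using p by (simp add: field_simps power2_eq_square)
  also have "p * (p - q - r) + q * (q - r - p) + r * (r - p - q) = 2 * p * q * r" using deg by algebra
  finally have sum: "?u + ?v + ?w = 1" using p by simp
  define s where "s = sqrt (2 * p * q * r)"
  have s: "s > 0" "s\<^sup>2 = 2 * p * q * r" using p by (simp_all add: s_def)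
  \<comment> \<open>The ratios y / z along the two lines, that is, the roots of r t^2 - (p - q - r)
    t + q.\<close>
  define t1 t2 where "t1 = (p - q - r + s) / (2 * r)" "t2 = (p - q - r - s) / (2 * r)"
  define d where "d t = t *\<^sub>R (B - A) + (C - A)" for t
  define l where "l t = range (\<lambda>x. Z + x *\<^sub>R d t)" for t
  have D: "cross2 (B - A) (C - A) \<noteq> 0" using nc by (simp add: collinear_iff_cross2)
  have d0: "d t \<noteq> 0" for t using cross2_indep[OF D, of t 1] by (auto simp: d_def)
  have t12: "t1 \<noteq> t2" using s p by (simp add: t1_t2_def)
  have fact: "(p - q - r) * y * z - q * z\<^sup>2 - r * y\<^sup>2 = - r * (y - t1 * z) * (y - t2 * z)" for y z
  proof -
    have "t1 + t2 = (p - q - r) / r" using p by (simp add: t1_t2_def field_simps)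
    moreover have "t1 * t2 = ((p - q - r)\<^sup>2 - s\<^sup>2) / (4 * r\<^sup>2)" using p by (simp add: t1_t2_def field_simps power2_eq_square)
    moreover have "(p - q - r)\<^sup>2 - s\<^sup>2 = 4 * q * r" unfolding s(2) using deg by algebra
    ultimately have "r * (t1 + t2) = p - q - r" "r * (t1 * t2) = q" using p by (simp_all add: power2_eq_square)
    then show ?thesis by algebra
  qed
  have mem: "Z + y *\<^sub>R (B - A) + z *\<^sub>R (C - A) \<in> bary_conic A B C p q r \<longleftrightarrow> y = t1 * z \<or> y = t2 * z" for y z
  proof -
    define u v w where "u = ?u" "v = ?v" "w = ?w"
    have u: "u = 1 - v - w" using sum by (simp add: u_v_w_def)
    \<comment> \<open>The rows of the kernel equation with u + v + w = 1 inserted; they cancel the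
      constant term and the terms linear in y and z.\<close>
    have g: "1 + r * v + q * w = 0" "r * u + p * w = -1" "q * u + p * v = -1"
      using p by (simp_all add: u_v_w_def field_simps)
    have "Z + y *\<^sub>R (B - A) + z *\<^sub>R (C - A) = bary A B C (u - y - z) (v + y) (w + z)"
      by (simp add: Z_def u_v_w_def bary_def algebra_simps)
    moreover have "u - y - z + (v + y) + (w + z) = 1" using u by simp
    ultimately have "Z + y *\<^sub>R (B - A) + z *\<^sub>R (C - A) \<in> bary_conic A B C p q r \<longleftrightarrow>
      1 + 2 * (p * (v + y) * (w + z) + q * (w + z) * (u - y - z) + r * (u - y - z) * (v + y)) = 0"
      using bary_in_bary_conic[OF nc] by metis
    also have "1 + 2 * (p * (v + y) * (w + z) + q * (w + z) * (u - y - z) + r * (u - y - z) * (v + y))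
        = 2 * ((p - q - r) * y * z - q * z\<^sup>2 - r * y\<^sup>2)"
      using g unfolding u by algebra
    also have "\<dots> = 0 \<longleftrightarrow> y = t1 * z \<or> y = t2 * z" unfolding fact using p by auto
    finally show ?thesis .
  qed
  have ll: "Z + y *\<^sub>R (B - A) + z *\<^sub>R (C - A) \<in> l t \<longleftrightarrow> y = t * z" for y z t
  proof -
    have "Z + y *\<^sub>R (B - A) + z *\<^sub>R (C - A) = Z + x *\<^sub>R d t \<longleftrightarrow> y = t * z \<and> x = z" for x
    proof
      assume "Z + y *\<^sub>R (B - A) + z *\<^sub>R (C - A) = Z + x *\<^sub>R d t"
      then have "(y - t * x) *\<^sub>R (B - A) + (z - x) *\<^sub>R (C - A) = 0" by (simp add: d_def algebra_simps)
      from cross2_indep[OF D this] show "y = t * z \<and> x = z" by auto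
    qed (simp add: d_def algebra_simps)
    then show ?thesis by (auto simp: l_def)
  qed
  have ex: "\<exists>y z. X = Z + y *\<^sub>R (B - A) + z *\<^sub>R (C - A)" for X
  proof -
    obtain y z where "X - Z = y *\<^sub>R (B - A) + z *\<^sub>R (C - A)" using cross2_coords[OF D] by blast
    then have "X = Z + y *\<^sub>R (B - A) + z *\<^sub>R (C - A)" by (simp only: diff_eq_eq ac_simps)
    then show ?thesis by blast
  qed
  have "bary_conic A B C p q r = l t1 \<union> l t2"
  proof (intro set_eqI)
    fix X
    obtain y z where "X = Z + y *\<^sub>R (B - A) + z *\<^sub>R (C - A)" using ex by blast
    then show "X \<in> bary_conic A B C p q r \<longleftrightarrow> X \<in> l t1 \<union> l t2" using mem ll by simp
  qed
  moreover have "l t1 \<inter> l t2 = {Z}"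
  proof (intro set_eqI)
    fix X
    obtain y z where X: "X = Z + y *\<^sub>R (B - A) + z *\<^sub>R (C - A)" using ex by blast
    have "X = Z \<longleftrightarrow> y = 0 \<and> z = 0" using cross2_indep[OF D, of y z] X by (auto simp: add.assoc)
    moreover have "y = t1 * z \<and> y = t2 * z \<longleftrightarrow> y = 0 \<and> z = 0" using t12 by auto
    ultimately show "X \<in> l t1 \<inter> l t2 \<longleftrightarrow> X \<in> {Z}" using ll X by simp
  qed
  ultimately show ?thesis
    using line_pair_center_eq[of "l t1" "l t2" Z] is_line_range[OF d0] by (simp add: l_def Z_def)
qed

subsection \<open>The circumcircle\<close>

text \<open>The parameter is half the central angle, so that it changes by inscribed angles and chords are
  \<open>2R\<bar>sin (s - t)\<bar>\<close>; the sign \<open>e\<close> of the orientation lets the vertices occur in the order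
  \<open>a < b < c < a + \<pi>\<close>.\<close>

definition circ_pt :: "real^2 \<Rightarrow> real \<Rightarrow> real \<Rightarrow> real \<Rightarrow> real^2" where
  "circ_pt Z R e t = Z + (R * cos (2 * t)) *\<^sub>R axis 1 1 + (e * R * sin (2 * t)) *\<^sub>R axis 2 1"

lemma circ_pt_components [simp]:
  "circ_pt Z R e t $ 1 = Z$1 + R * cos (2 * t)" "circ_pt Z R e t $ 2 = Z$2 + e * R * sin (2 * t)"
  by (simp_all add: circ_pt_def axis_def)

lemma circ_pt_pi: "circ_pt Z R e (t + pi) = circ_pt Z R e t"
proof -
  have "2 * (t + pi) = 2 * t + 2 * pi" by simp
  then show ?thesis unfolding vec2_eq_iff circ_pt_components by (simp only: cos_periodic sin_periodic)
qed

lemma continuous_on_circ_pt: "continuous_on S (circ_pt Z R e)"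
  unfolding circ_pt_def by (intro continuous_intros)

lemma dist_vec2: "dist (x::real^2) y = sqrt ((x$1 - y$1)\<^sup>2 + (x$2 - y$2)\<^sup>2)"
  by (simp add: dist_vec_def L2_set_def sum_2 dist_real_def)

lemma dist_circ_pt:
  assumes "R > 0" "e = 1 \<or> e = -1"
  shows "dist (circ_pt Z R e s) (circ_pt Z R e t) = 2 * R * \<bar>sin (s - t)\<bar>"
proof -
  have e: "e\<^sup>2 = 1" using assms(2) by auto
  have "(circ_pt Z R e s $ 1 - circ_pt Z R e t $ 1)\<^sup>2 + (circ_pt Z R e s $ 2 - circ_pt Z R e t $ 2)\<^sup>2 =
      R\<^sup>2 * ((cos (2 * s) - cos (2 * t))\<^sup>2 + e\<^sup>2 * (sin (2 * s) - sin (2 * t))\<^sup>2)"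
    unfolding circ_pt_components by algebra
  also have "\<dots> = R\<^sup>2 * (2 - 2 * cos (2 * s - 2 * t))"
    unfolding e cos_diff
    using sin_cos_squared_add[of "2 * s"] sin_cos_squared_add[of "2 * t"] by algebra
  also have "cos (2 * s - 2 * t) = 1 - 2 * (sin (s - t))\<^sup>2"
    using cos_double_sin[of "s - t"] by (simp add: right_diff_distrib)
  finally have "dist (circ_pt Z R e s) (circ_pt Z R e t) = sqrt ((2 * R * sin (s - t))\<^sup>2)"
    by (simp add: dist_vec2 power_mult_distrib)
  then show ?thesis using assms(1) by (simp add: abs_mult)
qed

lemma dist_center_circ_pt:
  assumes "R > 0" "e = 1 \<or> e = -1"
  shows "dist Z (circ_pt Z R e t) = R"
proof -
  have "(R * cos (2 * t))\<^sup>2 + (e * R * sin (2 * t))\<^sup>2 = R\<^sup>2"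
    using assms(2) sin_cos_squared_add[of "2 * t"] by algebra
  then show ?thesis using assms(1) by (simp add: dist_vec2)
qed

lemma circ_pt_surj:
  assumes "R > 0" "e = 1 \<or> e = -1" "dist Z X = R"
  obtains t where "t0 \<le> t" "t < t0 + pi" "X = circ_pt Z R e t"
proof -
  define x y where "x = (X$1 - Z$1) / R" "y = e * (X$2 - Z$2) / R"
  have e: "e * e = 1" using assms(2) by auto
  have "(X$1 - Z$1)\<^sup>2 + (X$2 - Z$2)\<^sup>2 = (dist X Z)\<^sup>2" by (simp add: dist_vec2)
  then have "(X$1 - Z$1)\<^sup>2 + (X$2 - Z$2)\<^sup>2 = R\<^sup>2" using assms(3) by (simp add: dist_commute)
  moreover have "x\<^sup>2 + y\<^sup>2 = ((X$1 - Z$1)\<^sup>2 + (X$2 - Z$2)\<^sup>2) / R\<^sup>2"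
    using e by (simp add: x_y_def power2_eq_square add_divide_distrib)
  ultimately have "x\<^sup>2 + y\<^sup>2 = 1" using assms(1) by simp
  then obtain \<theta> where \<theta>: "x = cos \<theta>" "y = sin \<theta>" using sincos_total_2pi by metis
  define t where "t = \<theta> / 2 - pi * of_int \<lfloor>(\<theta> / 2 - t0) / pi\<rfloor>"
  have "of_int \<lfloor>(\<theta> / 2 - t0) / pi\<rfloor> * pi \<le> \<theta> / 2 - t0" "\<theta> / 2 - t0 < (of_int \<lfloor>(\<theta> / 2 - t0) / pi\<rfloor> + 1) * pi"
    by (simp_all add: pos_le_divide_eq[symmetric] pos_divide_less_eq[symmetric])
  then have "t0 \<le> t" "t < t0 + pi" by (simp_all add: t_def algebra_simps)
  moreover have "X = circ_pt Z R e t"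
  proof -
    have "2 * t = \<theta> - 2 * pi * of_int \<lfloor>(\<theta> / 2 - t0) / pi\<rfloor>" by (simp add: t_def)
    then have "cos (2 * t) = cos \<theta>" "sin (2 * t) = sin \<theta>" by (simp_all add: cos_diff sin_diff)
    then have "cos (2 * t) = x" "sin (2 * t) = y" using \<theta> by simp_all
    moreover have "R * x = X$1 - Z$1" using assms(1) by (simp add: x_y_def)
    moreover have "e * R * y = (e * e) * (X$2 - Z$2)" using assms(1) by (simp add: x_y_def)
    ultimately show ?thesis using e by (simp add: vec2_eq_iff)
  qed
  ultimately show ?thesis using that by blast
qed

lemma circ_pt_eq_imp:
  assumes "R > 0" "e = 1 \<or> e = -1" "circ_pt Z R e s = circ_pt Z R e t" "\<bar>s - t\<bar> < pi"
  shows "s = t"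
proof -
  have "sin (s - t) = 0" using dist_circ_pt[OF assms(1,2), of Z s t] assms(1,3) by simp
  then show ?thesis using sin_eq_0_pi[of "s - t"] assms(4) by auto
qed

lemma circumcenter_exists:
  assumes "\<not> collinear {A, B, C :: real^2}"
  obtains Z where "dist Z A = dist Z B" "dist Z A = dist Z C"
proof -
  define p q where "p = B - A" "q = C - A"
  define D where "D = cross2 p q"
  have D: "D \<noteq> 0" using assms by (simp add: collinear_iff_cross2 D_def p_q_def)
  \<comment> \<open>Cramer's solution of the perpendicular bisector equations 2 (Z - A) . p = p . p
    and 2 (Z - A) . q = q . q.\<close>
  define Z where "Z = A + (((p \<bullet> p) * q$2 - (q \<bullet> q) * p$2) / (2 * D)) *\<^sub>R axis 1 1
    + (((q \<bullet> q) * p$1 - (p \<bullet> p) * q$1) / (2 * D)) *\<^sub>R axis 2 1"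
  have Zc: "Z$1 - A$1 = ((p \<bullet> p) * q$2 - (q \<bullet> q) * p$2) / (2 * D)"
    "Z$2 - A$2 = ((q \<bullet> q) * p$1 - (p \<bullet> p) * q$1) / (2 * D)"
    by (simp_all add: Z_def axis_def)
  have 1: "2 * ((Z$1 - A$1) * p$1 + (Z$2 - A$2) * p$2) = (p \<bullet> p) * (D / D)"
    "2 * ((Z$1 - A$1) * q$1 + (Z$2 - A$2) * q$2) = (q \<bullet> q) * (D / D)"
    unfolding Zc using D by (simp_all add: field_simps) (simp_all add: D_def cross2_def algebra_simps)
  have 2: "dist Z A = dist Z (A + r)" if "2 * ((Z$1 - A$1) * r$1 + (Z$2 - A$2) * r$2) = r \<bullet> r" for r
  proof -
    have "r \<bullet> r = (r$1)\<^sup>2 + (r$2)\<^sup>2" by (simp add: inner_vec_def sum_2 power2_eq_square)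
    then have "(Z$1 - (A$1 + r$1))\<^sup>2 + (Z$2 - (A$2 + r$2))\<^sup>2 = (Z$1 - A$1)\<^sup>2 + (Z$2 - A$2)\<^sup>2"
      using that by algebra
    then show ?thesis by (simp add: dist_vec2)
  qed
  show ?thesis using that[of Z] 2[of p] 2[of q] 1 D by (simp add: p_q_def)
qed

text \<open>Equidistance from two points is a linear equation, since the squares of the unknowns
  cancel; the two bisectors at A form a system whose determinant is that of the triangle.\<close>

lemma equidistant_unique:
  assumes "\<not> collinear {A, B, C :: real^2}"
    "dist z A = dist z B" "dist z A = dist z C" "dist Z A = dist Z B" "dist Z A = dist Z C"
  shows "z = Z"
proof -
  have D: "cross2 (B - A) (C - A) \<noteq> 0" using assms by (simp add: collinear_iff_cross2)
  have "2 * ((X - A)$1 * (Y - A)$1 + (X - A)$2 * (Y - A)$2) = ((Y - A)$1)\<^sup>2 + ((Y - A)$2)\<^sup>2"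
    if "dist X A = dist X Y" for X Y :: "real^2"
  proof -
    have "(X$1 - A$1)\<^sup>2 + (X$2 - A$2)\<^sup>2 = (X$1 - Y$1)\<^sup>2 + (X$2 - Y$2)\<^sup>2"
      using that by (simp add: dist_vec2)
    then show ?thesis unfolding vector_minus_component by algebra
  qed
  from this[OF assms(2)] this[OF assms(3)] this[OF assms(4)] this[OF assms(5)]
  have "cross2 (B - A) (C - A) * (z$1 - Z$1) = 0" "cross2 (B - A) (C - A) * (z$2 - Z$2) = 0"
    unfolding cross2_def vector_minus_component by algebra+
  then show ?thesis using D by (simp add: vec2_eq_iff)
qed

lemma circumcircle_eq:
  assumes "\<not> collinear {A, B, C}" "dist Z A = R" "dist Z B = R" "dist Z C = R"
  shows "circumcircle A B C = sphere Z R"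
  unfolding circumcircle_def
proof (rule the_equality)
  show "\<exists>z r. sphere Z R = sphere z r \<and> {A, B, C} \<subseteq> sphere Z R"
    using assms by auto
next
  fix S assume "\<exists>z r. S = sphere z r \<and> {A, B, C} \<subseteq> S"
  then obtain z r where *: "S = sphere z r" "{A, B, C} \<subseteq> S" by blast
  then have "z = Z" using equidistant_unique[OF assms(1), of z Z] assms by simp
  then show "S = sphere Z R" using * assms by simp
qed

text \<open>All differences b - a, c - b, c - a lie strictly between 0 and pi, so their sines and
  the sines and cosines of their halves are positive. The inequalities are stable under the cyclic
  shift to b, c, a + pi.\<close>

locale inscribed_triangle =
  fixes Z :: "real^2" and R e a b c :: real
  assumes R: "R > 0" and e: "e = 1 \<or> e = -1" and ab: "a < b" and bc: "b < c" and ca: "c < a + pi"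
begin

abbreviation P where "P \<equiv> circ_pt Z R e"
abbreviation "A \<equiv> P a"
abbreviation "B \<equiv> P b"
abbreviation "C \<equiv> P c"

end

lemma inscribed_triangle_exists:
  assumes nc: "\<not> collinear {A, B, C}"
  obtains Z R e a b c where "inscribed_triangle R e a b c"
    "A = circ_pt Z R e a" "B = circ_pt Z R e b" "C = circ_pt Z R e c"
proof -
  have ne: "A \<noteq> B" "B \<noteq> C" "A \<noteq> C" using nc by (auto simp: insert_commute)
  obtain Z where Z: "dist Z A = dist Z B" "dist Z A = dist Z C" by (rule circumcenter_exists[OF nc])
  define R where "R = dist Z A"
  have R: "R > 0" using Z ne by (auto simp: R_def)
  have pos: "\<exists>b. a < b \<and> b < a + pi \<and> X = circ_pt Z R 1 b"
    if X: "dist Z X = R" "circ_pt Z R 1 a \<noteq> X" for X a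
  proof -
    obtain b where b: "a \<le> b" "b < a + pi" "X = circ_pt Z R 1 b" using circ_pt_surj[OF R _ X(1), of 1 a] by auto
    moreover have "a \<noteq> b" using X b by auto
    ultimately show ?thesis by force
  qed
  have on: "dist Z A = R" "dist Z B = R" "dist Z C = R" using Z by (simp_all add: R_def)
  obtain a where a: "A = circ_pt Z R 1 a" using circ_pt_surj[OF R _ on(1), of 1] by blast
  obtain b where b: "a < b" "b < a + pi" "B = circ_pt Z R 1 b" 
    using pos[OF on(2), of a] ne(1) unfolding a[symmetric] by blast
  obtain c where c: "a < c" "c < a + pi" "C = circ_pt Z R 1 c" 
    using pos[OF on(3), of a] ne(3) unfolding a[symmetric] by blast
  have neg: "circ_pt Z R 1 t = circ_pt Z R (-1) (- t)" for t by (simp add: vec2_eq_iff)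
  have neg': "circ_pt Z R 1 t = circ_pt Z R (-1) (- t + pi)" for t by (simp only: circ_pt_pi neg)
  have "b \<noteq> c" using b c ne by auto
  then consider "b < c" | "c < b" by linarith
  then show ?thesis
  proof cases
    case 1
    with R b c have "inscribed_triangle R 1 a b c" by (simp add: inscribed_triangle_def)
    then show ?thesis using a b(3) c(3) by (rule that)
  next
    case 2
    \<comment> \<open>In the order a, c, b the circle is run through backwards: negating the
      parameters reverses the order, and adding pi to two of them moves these above -a
      again.\<close>
    with R b c have "inscribed_triangle R (-1) (- a) (- b + pi) (- c + pi)"
      by (simp add: inscribed_triangle_def)
    then show ?thesis using a[unfolded neg] b(3)[unfolded neg'] c(3)[unfolded neg']
      by (rule that)
  qed
qed

subsection \<open>The locus on one arc\<close>

lemma cos_squared_diff_sin_squared: "(cos x)\<^sup>2 - (sin y)\<^sup>2 = cos (x + y) * cos (x - y)" for x y :: real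
  unfolding cos_add cos_diff using sin_cos_squared_add[of x] sin_cos_squared_add[of y] by algebra

text \<open>In the application x, y, z are the chords PA, PB, PC over 2R, and k_a = k1 / s, k_b = k2
  / h, k_c = k3 / g. Then k_a^2 - 1 = y z / s^2, which gives p, and q and r arise likewise. The
  degeneracy condition is the assumed coordinate sum 1 multiplied by 2 p q r.\<close>

lemma degenerate_center_coords:
  fixes x y z s h g k1 k2 k3 :: real
  assumes pos: "x > 0" "y > 0" "z > 0" "s > 0" "h > 0" "g > 0"
    and k: "x * s\<^sup>2 - y * h\<^sup>2 - z * g\<^sup>2 = 2 * h * g * k1"
      "y * h\<^sup>2 - z * g\<^sup>2 - x * s\<^sup>2 = - 2 * s * g * k2"
      "z * g\<^sup>2 - x * s\<^sup>2 - y * h\<^sup>2 = - 2 * s * h * k3"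
    and sum: "x * k1 / (2 * h * g) - y * k2 / (2 * s * g) - z * k3 / (2 * s * h) = 1"
  defines "p \<equiv> 2 * s\<^sup>2 / (y * z)" and "q \<equiv> 2 * h\<^sup>2 / (z * x)" and "r \<equiv> 2 * g\<^sup>2 / (x * y)"
  shows "(p - q - r) / (2 * q * r) = x * k1 / (2 * h * g)"
    "(q - r - p) / (2 * r * p) = - y * k2 / (2 * s * g)"
    "(r - p - q) / (2 * p * q) = - z * k3 / (2 * s * h)"
    "p\<^sup>2 + q\<^sup>2 + r\<^sup>2 - 2 * p * q - 2 * q * r - 2 * r * p = 2 * p * q * r"
proof -
  have pqr: "p > 0" "q > 0" "r > 0" using pos by (simp_all add: p_def q_def r_def)
  have "p - q - r = 2 * (x * s\<^sup>2 - y * h\<^sup>2 - z * g\<^sup>2) / (x * y * z)"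
    "q - r - p = 2 * (y * h\<^sup>2 - z * g\<^sup>2 - x * s\<^sup>2) / (x * y * z)"
    "r - p - q = 2 * (z * g\<^sup>2 - x * s\<^sup>2 - y * h\<^sup>2) / (x * y * z)"
    unfolding p_def q_def r_def using pos by (simp_all add: field_simps)
  note d = this[unfolded k]
  show 1: "(p - q - r) / (2 * q * r) = x * k1 / (2 * h * g)"
    "(q - r - p) / (2 * r * p) = - y * k2 / (2 * s * g)"
    "(r - p - q) / (2 * p * q) = - z * k3 / (2 * s * h)"
    unfolding d unfolding p_def q_def r_def using pos by (simp_all add: field_simps power2_eq_square)
  have "(p - q - r) / (2 * q * r) + (q - r - p) / (2 * r * p) + (r - p - q) / (2 * p * q) = 1"
    unfolding 1 using sum by simp
  moreover have "(p - q - r) / (2 * q * r) + (q - r - p) / (2 * r * p) + (r - p - q) / (2 * p * q)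
      = (p * (p - q - r) + q * (q - r - p) + r * (r - p - q)) / (2 * p * q * r)"
    using pqr by (simp add: field_simps)
  ultimately have "p * (p - q - r) + q * (q - r - p) + r * (r - p - q) = 2 * p * q * r" using pqr by simp
  then show "p\<^sup>2 + q\<^sup>2 + r\<^sup>2 - 2 * p * q - 2 * q * r - 2 * r * p = 2 * p * q * r" by algebra
qed

text \<open>\<beta> and \<gamma> stand for half the angles at B and C, \<phi> for the position of P
  measured from the middle of the arc BC. The first three identities compute p - q - r and its
  cyclic companions up to a factor; the fourth is u + v + w = 1 cleared of denominators.\<close>

lemma half_angle_identities:
  fixes \<beta> \<gamma> \<phi> :: real
  defines "x \<equiv> cos (\<phi> + \<gamma> - \<beta>)" and "y \<equiv> cos (\<beta> + \<gamma> - \<phi>)" and "z \<equiv> cos (\<beta> + \<gamma> + \<phi>)"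
    and "s \<equiv> sin (\<beta> + \<gamma>)"
  shows "x * s\<^sup>2 - y * (sin \<beta>)\<^sup>2 - z * (sin \<gamma>)\<^sup>2 = 2 * sin \<beta> * sin \<gamma> * cos \<phi>"
    "y * (sin \<beta>)\<^sup>2 - z * (sin \<gamma>)\<^sup>2 - x * s\<^sup>2 = - 2 * s * sin \<gamma> * cos (\<phi> + \<gamma>)"
    "z * (sin \<gamma>)\<^sup>2 - x * s\<^sup>2 - y * (sin \<beta>)\<^sup>2 = - 2 * s * sin \<beta> * cos (\<phi> - \<beta>)"
    "x * cos \<phi> * s - y * cos (\<phi> + \<gamma>) * sin \<beta> - z * cos (\<phi> - \<beta>) * sin \<gamma> = 2 * sin \<beta> * sin \<gamma> * s"
proof -
  note sq = sin_cos_squared_add[of \<beta>] sin_cos_squared_add[of \<gamma>] sin_cos_squared_add[of \<phi>]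
  note ex = x_def y_def z_def s_def cos_add cos_diff sin_add
  show "x * s\<^sup>2 - y * (sin \<beta>)\<^sup>2 - z * (sin \<gamma>)\<^sup>2 = 2 * sin \<beta> * sin \<gamma> * cos \<phi>"
    unfolding ex using sq by algebra
  show "y * (sin \<beta>)\<^sup>2 - z * (sin \<gamma>)\<^sup>2 - x * s\<^sup>2 = - 2 * s * sin \<gamma> * cos (\<phi> + \<gamma>)"
    unfolding ex using sq by algebra
  show "z * (sin \<gamma>)\<^sup>2 - x * s\<^sup>2 - y * (sin \<beta>)\<^sup>2 = - 2 * s * sin \<beta> * cos (\<phi> - \<beta>)"
    unfolding ex using sq by algebra
  show "x * cos \<phi> * s - y * cos (\<phi> + \<gamma>) * sin \<beta> - z * cos (\<phi> - \<beta>) * sin \<gamma> = 2 * sin \<beta> * sin \<gamma> * s"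
    unfolding ex using sq by algebra
qed

lemma bary_half:
  "bary A B C 0 (1/2) (1/2) = midpoint B C" "bary A B C (1/2) 0 (1/2) = midpoint C A"
  "bary A B C (1/2) (1/2) 0 = midpoint A B"
  by (simp_all add: bary_def midpoint_def scaleR_right_distrib inverse_eq_divide)

lemma O_star_rotate: "O_star A B C = O_star B C A"
  by (simp add: O_star_def vertex_conic_def six_vertices_def Un_ac fun_eq_iff)

lemma cos_sin_double_eq_imp:
  fixes s t :: real
  assumes "cos (2 * s) = cos (2 * t)" "sin (2 * s) = sin (2 * t)" "\<bar>s - t\<bar> < pi"
  shows "s = t"
  using circ_pt_eq_imp[of 1 1 0 s t] assms by (simp add: circ_pt_def)

section \<open>The explicit curve of centers\<close>

context inscribed_triangle
begin

text \<open>The barycentric coordinates of \<open>O_star\<close> for \<open>P t\<close> on the arc \<open>b < t < c\<close>.\<close>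

definition u where "u t = sin (t - a) * cos (t - (b + c) / 2) / (2 * cos ((c - a) / 2) * sin ((b - a) / 2))"
definition v where "v t = - sin (t - b) * cos (t - (a + c) / 2) / (2 * cos ((c - b) / 2) * sin ((b - a) / 2))"
definition w where "w t = - sin (c - t) * sin (t - (a + b) / 2) / (2 * cos ((c - b) / 2) * cos ((c - a) / 2))"

definition locus where "locus t = bary (P a) (P b) (P c) (u t) (v t) (w t)"

lemma pos:
  "0 < sin (b - a)" "0 < sin (c - a)" "0 < sin (c - b)"
  "0 < sin ((b - a) / 2)" "0 < sin ((c - a) / 2)" "0 < sin ((c - b) / 2)"
  "0 < cos ((b - a) / 2)" "0 < cos ((c - a) / 2)" "0 < cos ((c - b) / 2)"
  using ab bc ca by (auto intro!: sin_gt_zero cos_gt_zero_pi)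

text \<open>The determinant of the sides at A is 4 e R^2 sin (b - a) sin (c - a) sin (c - b), a
  product of nonzero factors.\<close>

lemma noncollinear: "\<not> collinear {P a, P b, P c}"
proof -
  have half: "cos (2 * s) - cos (2 * t) = - 2 * sin (s - t) * sin (s + t)"
    "sin (2 * s) - sin (2 * t) = 2 * sin (s - t) * cos (s + t)" for s t :: real
  proof -
    have "2 * s = (s + t) + (s - t)" "2 * t = (s + t) - (s - t)" by simp_all
    then show "cos (2 * s) - cos (2 * t) = - 2 * sin (s - t) * sin (s + t)"
      "sin (2 * s) - sin (2 * t) = 2 * sin (s - t) * cos (s + t)"
      by (simp_all only: cos_add[of "s + t"] cos_diff[of "s + t"] sin_add[of "s + t"] sin_diff[of "s + t"]) simp_all
  qed
  have "cross2 (P b - P a) (P c - P a) = e * R\<^sup>2 *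
      ((cos (2 * b) - cos (2 * a)) * (sin (2 * c) - sin (2 * a))
       - (cos (2 * c) - cos (2 * a)) * (sin (2 * b) - sin (2 * a)))"
    unfolding cross2_def vector_minus_component circ_pt_components by algebra
  also have "\<dots> = 4 * e * R\<^sup>2 * sin (b - a) * sin (c - a) * (sin (c + a) * cos (b + a) - cos (c + a) * sin (b + a))"
    unfolding half by algebra
  also have "sin (c + a) * cos (b + a) - cos (c + a) * sin (b + a) = sin (c - b)"
    using sin_diff[of "c + a" "b + a"] by simp
  finally have "cross2 (P b - P a) (P c - P a) \<noteq> 0" using pos(1-3) R e by auto
  then show ?thesis by (simp add: collinear_iff_cross2)
qed

text \<open>With half central angles as parameters, the triangle has the angle b - a at C and pi -
  (c - a) at B; halving them gives \<gamma> and \<beta>.\<close>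

lemma half_angles:
  assumes \<beta>: "\<beta> = (a + pi - c) / 2" and \<gamma>: "\<gamma> = (b - a) / 2" and \<phi>: "\<phi> = t - (b + c) / 2"
  shows "sin (t - a) = cos (\<phi> + \<gamma> - \<beta>)" "sin (t - b) = cos (\<beta> + \<gamma> - \<phi>)" "sin (c - t) = cos (\<beta> + \<gamma> + \<phi>)"
    "cos (t - (b + c) / 2) = cos \<phi>" "cos (t - (a + c) / 2) = cos (\<phi> + \<gamma>)" "sin (t - (a + b) / 2) = cos (\<phi> - \<beta>)"
    "cos ((c - a) / 2) = sin \<beta>" "sin ((b - a) / 2) = sin \<gamma>" "cos ((c - b) / 2) = sin (\<beta> + \<gamma>)"
    "sin (c - b) = 2 * sin (\<beta> + \<gamma>) * cos (\<beta> + \<gamma>)" "sin (c - a) = 2 * sin \<beta> * cos \<beta>"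
    "sin (b - a) = 2 * sin \<gamma> * cos \<gamma>"
proof -
  have sc: "sin t = cos x" if "t = pi / 2 - x" for t x :: real using that by (simp add: sin_cos_eq)
  have cs: "cos t = sin x" if "t = pi / 2 - x" for t x :: real using that by (simp add: cos_sin_eq)
  have dbl: "sin t = 2 * sin x * cos x" if "t = 2 * x \<or> t = pi - 2 * x" for t x :: real
    using that by (auto simp: sin_double)
  have sc': "sin t = cos x" if "t = pi / 2 + x" for t x :: real using that by (simp add: sin_add)
  show "sin (t - a) = cos (\<phi> + \<gamma> - \<beta>)" by (rule sc') (simp add: \<beta> \<gamma> \<phi> field_simps)
  show "sin (t - b) = cos (\<beta> + \<gamma> - \<phi>)" by (rule sc) (simp add: \<beta> \<gamma> \<phi> field_simps)
  show "sin (c - t) = cos (\<beta> + \<gamma> + \<phi>)" by (rule sc) (simp add: \<beta> \<gamma> \<phi> field_simps)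
  show "sin (t - (a + b) / 2) = cos (\<phi> - \<beta>)" by (rule sc') (simp add: \<beta> \<gamma> \<phi> field_simps)
  show "cos ((c - a) / 2) = sin \<beta>" "cos ((c - b) / 2) = sin (\<beta> + \<gamma>)"
    by (rule cs, simp add: \<beta> \<gamma> \<phi> field_simps)+
  show "sin (c - b) = 2 * sin (\<beta> + \<gamma>) * cos (\<beta> + \<gamma>)" "sin (c - a) = 2 * sin \<beta> * cos \<beta>"
    "sin (b - a) = 2 * sin \<gamma> * cos \<gamma>"
    by (rule dbl, simp add: \<beta> \<gamma> \<phi> field_simps)+
  have "t - (a + c) / 2 = \<phi> + \<gamma>" by (simp add: \<beta> \<gamma> \<phi> field_simps)
  then show "cos (t - (a + c) / 2) = cos (\<phi> + \<gamma>)" by simp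
qed (simp_all add: \<gamma> \<phi>)

text \<open>Valid for every real t, so that \<open>locus t\<close> is an affine combination of the
  vertices also beyond the arc, where the midpoints lie.\<close>

lemma sum_uvw: "u t + v t + w t = 1"
proof -
  define \<beta> \<gamma> \<phi> where "\<beta> = (a + pi - c) / 2" "\<gamma> = (b - a) / 2" "\<phi> = t - (b + c) / 2"
  note h = half_angles[OF \<beta>_\<gamma>_\<phi>_def]
  define x y z s where "x = cos (\<phi> + \<gamma> - \<beta>)" "y = cos (\<beta> + \<gamma> - \<phi>)" "z = cos (\<beta> + \<gamma> + \<phi>)" "s = sin (\<beta> + \<gamma>)"
  have nz: "sin \<beta> \<noteq> 0" "sin \<gamma> \<noteq> 0" "s \<noteq> 0" using pos(4,8,9) unfolding h x_y_z_s_def by simp_all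
  have "u t + v t + w t = (x * cos \<phi> * s - y * cos (\<phi> + \<gamma>) * sin \<beta> - z * cos (\<phi> - \<beta>) * sin \<gamma>) / (2 * sin \<beta> * sin \<gamma> * s)"
    unfolding u_def v_def w_def h x_y_z_s_def[symmetric] using nz by (simp add: field_simps)
  also have "\<dots> = 1"
    using half_angle_identities(4)[of \<phi> \<gamma> \<beta>] nz unfolding x_y_z_s_def by simp
  finally show ?thesis .
qed

lemma O_star_eq_locus:
  assumes "b < t" "t < c"
  shows "O_star (P a) (P b) (P c) (P t) = locus t"
proof -
  define \<beta> \<gamma> \<phi> where "\<beta> = (a + pi - c) / 2" "\<gamma> = (b - a) / 2" "\<phi> = t - (b + c) / 2"
  note h = half_angles[OF \<beta>_\<gamma>_\<phi>_def]
  define x y z s where "x = cos (\<phi> + \<gamma> - \<beta>)" "y = cos (\<beta> + \<gamma> - \<phi>)" "z = cos (\<beta> + \<gamma> + \<phi>)" "s = sin (\<beta> + \<gamma>)"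
  note h = h[folded x_y_z_s_def]
  have xyz: "x > 0" "y > 0" "z > 0"
    using sin_gt_zero[of "t - a"] sin_gt_zero[of "t - b"] sin_gt_zero[of "c - t"] assms ab bc ca
    unfolding h by auto
  have sn: "s > 0" "sin \<beta> > 0" "sin \<gamma> > 0" using pos(4,8,9) unfolding h by simp_all
  have dx: "dist (P t) (P a) = 2 * R * x" "dist (P t) (P b) = 2 * R * y" "dist (P t) (P c) = 2 * R * z"
  proof -
    have "\<bar>sin (t - c)\<bar> = \<bar>sin (c - t)\<bar>" using sin_minus[of "c - t"] by simp
    then show "dist (P t) (P a) = 2 * R * x" "dist (P t) (P b) = 2 * R * y" "dist (P t) (P c) = 2 * R * z"
      using xyz unfolding dist_circ_pt[OF R e] h by simp_all
  qed
  have da: "dist (P b) (P c) = 2 * R * (2 * s * cos (\<beta> + \<gamma>))" "dist (P c) (P a) = 2 * R * (2 * sin \<beta> * cos \<beta>)"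
    "dist (P a) (P b) = 2 * R * (2 * sin \<gamma> * cos \<gamma>)"
  proof -
    have "\<bar>sin (b - c)\<bar> = \<bar>sin (c - b)\<bar>" "\<bar>sin (a - b)\<bar> = \<bar>sin (b - a)\<bar>"
      using sin_minus[of "c - b"] sin_minus[of "b - a"] by simp_all
    then show "dist (P b) (P c) = 2 * R * (2 * s * cos (\<beta> + \<gamma>))" "dist (P c) (P a) = 2 * R * (2 * sin \<beta> * cos \<beta>)"
      "dist (P a) (P b) = 2 * R * (2 * sin \<gamma> * cos \<gamma>)"
      using pos(1-3) unfolding dist_circ_pt[OF R e] h(10-12)[symmetric] by simp_all
  qed
  have two: "cos (X - Y) + cos (X + Y) = 2 * cos X * cos Y" for X Y :: real by (simp add: cos_add cos_diff)
  have sums: "y + z = 2 * cos (\<beta> + \<gamma>) * cos \<phi>" "z + x = 2 * cos (\<phi> + \<gamma>) * cos \<beta>" "x + y = 2 * cos (\<phi> - \<beta>) * cos \<gamma>"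
  proof -
    show "y + z = 2 * cos (\<beta> + \<gamma>) * cos \<phi>" unfolding x_y_z_s_def by (rule two)
    show "z + x = 2 * cos (\<phi> + \<gamma>) * cos \<beta>"
      using two[of "\<phi> + \<gamma>" \<beta>] unfolding x_y_z_s_def by (simp add: ac_simps)
    have "cos (\<beta> + \<gamma> - \<phi>) = cos (\<phi> - \<beta> - \<gamma>)" using cos_minus[of "\<beta> + \<gamma> - \<phi>"] by (simp add: algebra_simps)
    then show "x + y = 2 * cos (\<phi> - \<beta>) * cos \<gamma>"
      using two[of "\<phi> - \<beta>" \<gamma>] unfolding x_y_z_s_def by (simp add: algebra_simps)
  qed
  have prods: "(cos \<phi>)\<^sup>2 - s\<^sup>2 = y * z" "(cos (\<phi> + \<gamma>))\<^sup>2 - (sin \<beta>)\<^sup>2 = z * x" "(cos (\<phi> - \<beta>))\<^sup>2 - (sin \<gamma>)\<^sup>2 = x * y"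
  proof -
    have m: "cos (\<phi> - (\<beta> + \<gamma>)) = cos (\<beta> + \<gamma> - \<phi>)" "cos (\<phi> - \<beta> - \<gamma>) = cos (\<beta> + \<gamma> - \<phi>)"
      using cos_minus[of "\<beta> + \<gamma> - \<phi>"] by (simp_all add: algebra_simps)
    show "(cos \<phi>)\<^sup>2 - s\<^sup>2 = y * z" "(cos (\<phi> + \<gamma>))\<^sup>2 - (sin \<beta>)\<^sup>2 = z * x" "(cos (\<phi> - \<beta>))\<^sup>2 - (sin \<gamma>)\<^sup>2 = x * y"
      unfolding x_y_z_s_def cos_squared_diff_sin_squared m by (simp_all add: algebra_simps)
  qed
  have cpos: "cos (\<beta> + \<gamma>) > 0" "cos \<beta> > 0" "cos \<gamma> > 0"
    using pos(1-3) sn unfolding h by (simp_all add: zero_less_mult_iff)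
  have kpos: "cos \<phi> > 0" "cos (\<phi> + \<gamma>) > 0" "cos (\<phi> - \<beta>) > 0"
  proof -
    have "y + z > 0" "z + x > 0" "x + y > 0" using xyz by simp_all
    then show "cos \<phi> > 0" "cos (\<phi> + \<gamma>) > 0" "cos (\<phi> - \<beta>) > 0"
      using cpos unfolding sums by (simp_all add: zero_less_mult_iff)
  qed
  \<comment> \<open>PB + PC = 4R cos (\<beta> + \<gamma>) cos \<phi> and BC = 4R s cos (\<beta> +
    \<gamma>), so the ratio for the side BC is cos \<phi> / s; the other two are formed in the same
    way.\<close>
  define ka kb kc where "ka = cos \<phi> / s" "kb = cos (\<phi> + \<gamma>) / sin \<beta>" "kc = cos (\<phi> - \<beta>) / sin \<gamma>"
  have k2: "ka\<^sup>2 - 1 = y * z / s\<^sup>2" "kb\<^sup>2 - 1 = z * x / (sin \<beta>)\<^sup>2" "kc\<^sup>2 - 1 = x * y / (sin \<gamma>)\<^sup>2"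
    unfolding prods[symmetric] ka_kb_kc_def using sn by (simp_all add: power_divide diff_divide_distrib)
  have gt1: "k > 1" if "k > 0" "k\<^sup>2 - 1 > 0" for k :: real
    using that power_le_one[of k 2] by linarith
  have k1: "ka > 1" "kb > 1" "kc > 1"
  proof -
    have "ka > 0" "kb > 0" "kc > 0" using sn kpos by (simp_all add: ka_kb_kc_def)
    moreover have "ka\<^sup>2 - 1 > 0" "kb\<^sup>2 - 1 > 0" "kc\<^sup>2 - 1 > 0" unfolding k2 using xyz sn by simp_all
    ultimately show "ka > 1" "kb > 1" "kc > 1" by (simp_all only: gt1)
  qed
  have dk: "dist (P t) (P b) + dist (P t) (P c) = ka * dist (P b) (P c)"
    "dist (P t) (P c) + dist (P t) (P a) = kb * dist (P c) (P a)"
    "dist (P t) (P a) + dist (P t) (P b) = kc * dist (P a) (P b)"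
  proof -
    have "2 * R * y + 2 * R * z = 2 * R * (y + z)" "2 * R * z + 2 * R * x = 2 * R * (z + x)"
      "2 * R * x + 2 * R * y = 2 * R * (x + y)" by (simp_all add: algebra_simps)
    then show "dist (P t) (P b) + dist (P t) (P c) = ka * dist (P b) (P c)"
      "dist (P t) (P c) + dist (P t) (P a) = kb * dist (P c) (P a)"
      "dist (P t) (P a) + dist (P t) (P b) = kc * dist (P a) (P b)"
      unfolding dx da sums ka_kb_kc_def using sn by (simp_all add: sums)
  qed
  have "2 / (ka\<^sup>2 - 1) = 2 * s\<^sup>2 / (y * z)" "2 / (kb\<^sup>2 - 1) = 2 * (sin \<beta>)\<^sup>2 / (z * x)"
    "2 / (kc\<^sup>2 - 1) = 2 * (sin \<gamma>)\<^sup>2 / (x * y)" unfolding k2 by simp_all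
  note vc = vertex_conic_eq[OF noncollinear dk(1) k1(1) dk(2) k1(2) dk(3) k1(3), unfolded this]
  have sum: "x * cos \<phi> / (2 * sin \<beta> * sin \<gamma>) - y * cos (\<phi> + \<gamma>) / (2 * s * sin \<gamma>)
      - z * cos (\<phi> - \<beta>) / (2 * s * sin \<beta>) = 1"
    using sum_uvw[of t] unfolding u_def v_def w_def h by simp
  note cc = degenerate_center_coords[OF xyz sn half_angle_identities(1-3)[where \<phi> = \<phi> and \<gamma> = \<gamma> and \<beta> = \<beta>, folded x_y_z_s_def] sum]
  have "O_star (P a) (P b) (P c) (P t) = bary (P a) (P b) (P c) (x * cos \<phi> / (2 * sin \<beta> * sin \<gamma>))
      (- y * cos (\<phi> + \<gamma>) / (2 * s * sin \<gamma>)) (- z * cos (\<phi> - \<beta>) / (2 * s * sin \<beta>))"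
    unfolding O_star_def vc
    by (subst line_pair_center_bary_conic[OF noncollinear _ _ _ cc(4)]) (use xyz sn cc(1-3) in simp_all)
  then show ?thesis unfolding locus_def u_def v_def w_def h .
qed

text \<open>Products become sums in the double angle: v carries a sine with phase \<open>m\<close>
  and w a cosine with phase \<open>n\<close>. Since m and n differ by (c - b) / 2 < pi / 2, these
  two are linearly independent, and the ellipse does not collapse to a segment.\<close>

lemma locus_harmonic:
  obtains ctr E F where "cross2 E F \<noteq> 0" "\<And>t. locus t = ctr + cos (2 * t) *\<^sub>R E + sin (2 * t) *\<^sub>R F"
proof -
  define K M m n where "K = 4 * cos ((c - b) / 2) * sin ((b - a) / 2)"
    "M = 4 * cos ((c - b) / 2) * cos ((c - a) / 2)" "m = b + (a + c) / 2" "n = c + (a + b) / 2"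
  have KM: "K > 0" "M > 0" using pos by (simp_all add: K_M_m_n_def)
  define v0 v1 v2 where "v0 = - sin ((a + c) / 2 - b) / K" "v1 = sin m / K" "v2 = - cos m / K"
  define w0 w1 w2 where "w0 = cos (c - (a + b) / 2) / M" "w1 = - cos n / M" "w2 = - sin n / M"
  have v: "v t = v0 + v1 * cos (2 * t) + v2 * sin (2 * t)" for t
  proof -
    have "v t = - (2 * (sin (t - b) * cos (t - (a + c) / 2))) / K" by (simp add: v_def K_M_m_n_def)
    also have "2 * (sin (t - b) * cos (t - (a + c) / 2)) = sin (2 * t - m) + sin ((a + c) / 2 - b)"
      unfolding sin_times_cos by (simp add: K_M_m_n_def algebra_simps)
    also have "- (sin (2 * t - m) + sin ((a + c) / 2 - b)) / K = v0 + v1 * cos (2 * t) + v2 * sin (2 * t)"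
      unfolding sin_diff[of "2 * t" m] v0_v1_v2_def using KM by (simp add: field_simps)
    finally show ?thesis .
  qed
  have w: "w t = w0 + w1 * cos (2 * t) + w2 * sin (2 * t)" for t
  proof -
    have "w t = - (2 * (sin (c - t) * sin (t - (a + b) / 2))) / M" by (simp add: w_def K_M_m_n_def)
    also have "2 * (sin (c - t) * sin (t - (a + b) / 2)) = cos (n - 2 * t) - cos (c - (a + b) / 2)"
      unfolding sin_times_sin by (simp add: K_M_m_n_def algebra_simps diff_divide_distrib)
    also have "- (cos (n - 2 * t) - cos (c - (a + b) / 2)) / M = w0 + w1 * cos (2 * t) + w2 * sin (2 * t)"
      unfolding cos_diff[of n "2 * t"] w0_w1_w2_def using KM by (simp add: field_simps)
    finally show ?thesis .
  qed
  define E F where "E = v1 *\<^sub>R (B - A) + w1 *\<^sub>R (C - A)" "F = v2 *\<^sub>R (B - A) + w2 *\<^sub>R (C - A)"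
  have "cross2 E F = (v1 * w2 - v2 * w1) * cross2 (B - A) (C - A)"
    by (simp add: E_F_def cross2_def algebra_simps)
  also have "v1 * w2 - v2 * w1 = - cos (m - n) / (K * M)"
    unfolding cos_diff using KM by (simp add: v0_v1_v2_def w0_w1_w2_def field_simps)
  also have "cos (m - n) = cos ((c - b) / 2)"
  proof -
    have "m - n = - ((c - b) / 2)" by (simp add: K_M_m_n_def field_simps)
    then show ?thesis by (simp only: cos_minus)
  qed
  finally have "cross2 E F \<noteq> 0" using pos(9) KM noncollinear by (simp add: collinear_iff_cross2)
  moreover have "locus t = (A + v0 *\<^sub>R (B - A) + w0 *\<^sub>R (C - A)) + cos (2 * t) *\<^sub>R E + sin (2 * t) *\<^sub>R F" for t
    unfolding locus_def bary_alt[OF sum_uvw] unfolding v w E_F_def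
    by (simp add: scaleR_add_left scaleR_add_right mult.commute)
  ultimately show ?thesis by (rule that)
qed

lemma is_ellipse_locus: "is_ellipse (range locus)"
proof -
  obtain ctr E F where *: "cross2 E F \<noteq> 0" "\<And>t. locus t = ctr + cos (2 * t) *\<^sub>R E + sin (2 * t) *\<^sub>R F"
    using locus_harmonic by metis
  have "range locus = range (\<lambda>s. ctr + cos s *\<^sub>R E + sin s *\<^sub>R F)"
  proof -
    have "ctr + cos s *\<^sub>R E + sin s *\<^sub>R F \<in> range locus" for s
      by (rule range_eqI[of _ _ "s / 2"]) (simp add: *)
    moreover have "locus t \<in> range (\<lambda>s. ctr + cos s *\<^sub>R E + sin s *\<^sub>R F)" for t
      by (rule range_eqI[of _ _ "2 * t"]) (rule *)
    ultimately show ?thesis by blast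
  qed
  then show ?thesis using is_ellipse_range[OF *(1)] by simp
qed

lemma continuous_on_locus: "continuous_on S locus"
proof -
  obtain ctr E F where *: "\<And>t. locus t = ctr + cos (2 * t) *\<^sub>R E + sin (2 * t) *\<^sub>R F"
    using locus_harmonic by metis
  show ?thesis unfolding * by (intro continuous_intros)
qed

lemma locus_inj: "locus s = locus t \<Longrightarrow> \<bar>s - t\<bar> < pi \<Longrightarrow> s = t"
proof -
  assume eq: "locus s = locus t" and st: "\<bar>s - t\<bar> < pi"
  obtain ctr E F where *: "cross2 E F \<noteq> 0" "\<And>t. locus t = ctr + cos (2 * t) *\<^sub>R E + sin (2 * t) *\<^sub>R F"
    using locus_harmonic by metis
  have "(cos (2 * s) - cos (2 * t)) *\<^sub>R E + (sin (2 * s) - sin (2 * t)) *\<^sub>R F = 0"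
    using eq unfolding * by (simp add: algebra_simps)
  from cross2_indep[OF *(1) this] have "cos (2 * s) = cos (2 * t)" "sin (2 * s) = sin (2 * t)" by auto
  then show "s = t" using st by (rule cos_sin_double_eq_imp)
qed

text \<open>Each coordinate is a product of two trigonometric factors; the one containing the mean
  of two parameters has the zero that gives the midpoint. A second coordinate is 1/2 there, and the
  sum 1 yields the third.\<close>

lemma midpoints_in_locus: "{midpoint B C, midpoint C A, midpoint A B} \<subseteq> range locus"
proof -
  have "midpoint B C \<in> range locus"
  proof (rule range_eqI)
    define t where "t = (b + c) / 2 + pi / 2"
    have e: "t - b = (c - b) / 2 + pi / 2" "t - (a + c) / 2 = (b - a) / 2 + pi / 2" "t - (b + c) / 2 = pi / 2"
      by (simp_all add: t_def field_simps)
    have uvw: "u t = 0" "v t = 1 / 2" using pos unfolding u_def v_def e by (simp_all add: sin_add cos_add)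
    then have "w t = 1 / 2" using sum_uvw[of t] by simp
    then show "midpoint B C = locus t" unfolding locus_def uvw by (simp only: bary_half)
  qed
  moreover have "midpoint C A \<in> range locus"
  proof (rule range_eqI)
    define t where "t = (a + c) / 2 + pi / 2"
    have e: "t - a = (c - a) / 2 + pi / 2" "t - (b + c) / 2 = - ((b - a) / 2) + pi / 2" "t - (a + c) / 2 = pi / 2"
      by (simp_all add: t_def field_simps)
    have uvw: "v t = 0" "u t = 1 / 2" using pos unfolding u_def v_def e by (simp_all add: sin_add cos_add cos_diff)
    then have "w t = 1 / 2" using sum_uvw[of t] by simp
    then show "midpoint C A = locus t" unfolding locus_def uvw by (simp only: bary_half)
  qed
  moreover have "midpoint A B \<in> range locus"
  proof (rule range_eqI)
    define t where "t = (a + b) / 2"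
    have e: "t - a = (b - a) / 2" "t - (b + c) / 2 = - ((c - a) / 2)" "t - (a + b) / 2 = 0"
      by (simp_all add: t_def field_simps)
    have uvw: "w t = 0" "u t = 1 / 2" using pos unfolding u_def w_def e by simp_all
    then have "v t = 1 / 2" using sum_uvw[of t] by simp
    then show "midpoint A B = locus t" unfolding locus_def uvw by (simp only: bary_half)
  qed
  ultimately show ?thesis by blast
qed

section \<open>The ends of the arc as vertices of V-ellipses\<close>

lemma sin_half_double: "sin x = 2 * sin (x / 2) * cos (x / 2)" for x :: real
  using sin_double[of "x / 2"] by simp

text \<open>The vanishing B-coordinate puts this end on the line CA, and u > 0 > w puts it beyond A
  as seen from C.\<close>

lemma locus_b: "v b = 0"
  "u b = cos ((b - a) / 2) * cos ((c - b) / 2) / cos ((c - a) / 2)"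
  "w b = - sin ((b - a) / 2) * sin ((c - b) / 2) / cos ((c - a) / 2)"
proof -
  note 1 = sin_half_double[of "b - a"] sin_half_double[of "c - b"]
  have 2: "b - (b + c) / 2 = - ((c - b) / 2)" "b - (a + b) / 2 = (b - a) / 2"
    by (simp_all add: field_simps)
  show "v b = 0" by (simp add: v_def)
  show "u b = cos ((b - a) / 2) * cos ((c - b) / 2) / cos ((c - a) / 2)"
    "w b = - sin ((b - a) / 2) * sin ((c - b) / 2) / cos ((c - a) / 2)"
    unfolding u_def w_def 1 2 cos_minus using pos by (simp_all add: field_simps)
qed

lemma locus_c: "w c = 0"
  "u c = sin ((c - a) / 2) * cos ((c - b) / 2) / sin ((b - a) / 2)"
  "v c = - cos ((c - a) / 2) * sin ((c - b) / 2) / sin ((b - a) / 2)"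
proof -
  note 1 = sin_half_double[of "c - a"] sin_half_double[of "c - b"]
  have 2: "c - (b + c) / 2 = (c - b) / 2" "c - (a + c) / 2 = (c - a) / 2"
    by (simp_all add: field_simps)
  show "w c = 0" by (simp add: w_def)
  show "u c = sin ((c - a) / 2) * cos ((c - b) / 2) / sin ((b - a) / 2)"
    "v c = - cos ((c - a) / 2) * sin ((c - b) / 2) / sin ((b - a) / 2)"
    unfolding u_def v_def 1 2 using pos by (simp_all add: field_simps)
qed

lemma vertices_distinct: "A \<noteq> B" "B \<noteq> C" "C \<noteq> A"
  using noncollinear by (auto simp: insert_commute)

lemma dist_vertices: "dist A B = 2 * R * sin (b - a)" "dist B C = 2 * R * sin (c - b)" "dist C A = 2 * R * sin (c - a)"
proof -
  have "\<bar>sin (b - c)\<bar> = \<bar>sin (c - b)\<bar>" "\<bar>sin (a - b)\<bar> = \<bar>sin (b - a)\<bar>"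
    using sin_minus[of "c - b"] sin_minus[of "b - a"] by simp_all
  then show "dist A B = 2 * R * sin (b - a)" "dist B C = 2 * R * sin (c - b)" "dist C A = 2 * R * sin (c - a)"
    using pos(1-3) unfolding dist_circ_pt[OF R e] by simp_all
qed

text \<open>\<open>k\<close> is (BC + BA) / CA, which sum-to-product turns into cos (X - Y) / cos (X
  + Y). The difference of the squared cosines is 4 cos X cos Y sin X sin Y, and this identifies k^2
  - 1 with -4 w u, the equation of the vertices on CA.\<close>

lemma locus_b_focal_vertex: "locus b \<in> focal_vertices C A B"
proof -
  define X Y where "X = (b - a) / 2" "Y = (c - b) / 2"
  have XY: "(c - a) / 2 = X + Y" "b - a = 2 * X" "c - b = 2 * Y" "c - a = 2 * (X + Y)" by (simp_all add: X_Y_def field_simps)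
  define k where "k = cos (X - Y) / cos (X + Y)"
  have p': "sin X > 0" "cos X > 0" "sin Y > 0" "cos Y > 0" "cos (X + Y) > 0"
    using pos(4-9) unfolding X_Y_def[symmetric] XY(1) by simp_all
  have "cos (X - Y) - cos (X + Y) = 2 * sin X * sin Y" by (simp add: cos_add cos_diff)
  moreover have "2 * sin X * sin Y > 0" using p' by simp
  ultimately have "cos (X + Y) < cos (X - Y)" by linarith
  then have k: "k > 1" using p' by (simp add: k_def)
  have d: "dist B C + dist B A = k * dist C A"
  proof -
    have "sin (2 * X) + sin (2 * Y) = k * sin (2 * (X + Y))"
    proof -
      have "sin (2 * (X + Y)) = 2 * sin (X + Y) * cos (X + Y)" by (rule sin_double)
      then have "k * sin (2 * (X + Y)) = 2 * (sin (X + Y) * cos (X - Y))" using p' by (simp add: k_def)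
      also have "\<dots> = sin (2 * X) + sin (2 * Y)" unfolding sin_times_cos by (simp add: algebra_simps)
      finally show ?thesis by simp
    qed
    then have "2 * R * (sin (2 * X) + sin (2 * Y)) = 2 * R * (k * sin (2 * (X + Y)))" by simp
    then show ?thesis unfolding dist_commute[of B A] dist_vertices XY(2-4) by (simp add: algebra_simps)
  qed
  have uw: "w b + u b = 1" using sum_uvw[of b] locus_b(1) by simp
  have "(k\<^sup>2 - 1) * (cos (X + Y))\<^sup>2 = - 4 * (w b * u b) * (cos (X + Y))\<^sup>2"
  proof -
    have "(k\<^sup>2 - 1) * (cos (X + Y))\<^sup>2 = (cos (X - Y))\<^sup>2 - (cos (X + Y))\<^sup>2" 
      using p' by (simp add: k_def field_simps)
    also have "\<dots> = 4 * (cos X * cos Y) * (sin X * sin Y)" unfolding cos_add cos_diff by algebra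
    also have "\<dots> = - 4 * (w b * u b) * (cos (X + Y))\<^sup>2"
      unfolding locus_b XY(1) X_Y_def[symmetric] using p' by (simp add: power2_eq_square)
    finally show ?thesis .
  qed
  moreover have "(cos (X + Y))\<^sup>2 \<noteq> 0" using p' by simp
  ultimately have kk: "k\<^sup>2 - 1 = - 4 * (w b * u b)" using mult_right_cancel by blast
  have "k\<^sup>2 - 1 > 0" using k by (simp add: one_less_power)
  then have "1 + 2 * (2 / (k\<^sup>2 - 1) * w b * u b) = 0" using kk by (simp add: field_simps)
  moreover have "locus b = w b *\<^sub>R C + u b *\<^sub>R A" by (simp add: locus_def bary_def locus_b(1))
  ultimately show ?thesis unfolding focal_vertices_eq[OF vertices_distinct(3) d k] using uw by blast
qed

text \<open>The companion at the other end: with X = (c - a) / 2 the ratio (CA + CB) / AB is sin (X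
  + Y) / sin (X - Y), and the difference of the squared sines factors in the same way.\<close>

lemma locus_c_focal_vertex: "locus c \<in> focal_vertices A B C"
proof -
  define X Y where "X = (c - a) / 2" "Y = (c - b) / 2"
  have XY: "(b - a) / 2 = X - Y" "b - a = 2 * (X - Y)" "c - b = 2 * Y" "c - a = 2 * X" by (simp_all add: X_Y_def field_simps)
  define k where "k = sin (X + Y) / sin (X - Y)"
  have p': "sin X > 0" "cos X > 0" "sin Y > 0" "cos Y > 0" "sin (X - Y) > 0"
    using pos(4-9) unfolding X_Y_def[symmetric] XY(1) by simp_all
  have "sin (X + Y) - sin (X - Y) = 2 * cos X * sin Y" by (simp add: sin_add sin_diff)
  moreover have "2 * cos X * sin Y > 0" using p' by simp
  ultimately have "sin (X - Y) < sin (X + Y)" by linarith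
  then have k: "k > 1" using p' by (simp add: k_def)
  have d: "dist C A + dist C B = k * dist A B"
  proof -
    have "sin (2 * X) + sin (2 * Y) = k * sin (2 * (X - Y))"
    proof -
      have "sin (2 * (X - Y)) = 2 * sin (X - Y) * cos (X - Y)" by (rule sin_double)
      then have "k * sin (2 * (X - Y)) = 2 * (sin (X + Y) * cos (X - Y))" using p' by (simp add: k_def)
      also have "\<dots> = sin (2 * X) + sin (2 * Y)" unfolding sin_times_cos by (simp add: algebra_simps)
      finally show ?thesis by simp
    qed
    then have "2 * R * (sin (2 * X) + sin (2 * Y)) = 2 * R * (k * sin (2 * (X - Y)))" by simp
    then show ?thesis unfolding dist_commute[of C B] dist_vertices XY(2-4) by (simp add: algebra_simps)
  qed
  have uv: "u c + v c = 1" using sum_uvw[of c] locus_c(1) by simp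
  have "(k\<^sup>2 - 1) * (sin (X - Y))\<^sup>2 = - 4 * (u c * v c) * (sin (X - Y))\<^sup>2"
  proof -
    have "(k\<^sup>2 - 1) * (sin (X - Y))\<^sup>2 = (sin (X + Y))\<^sup>2 - (sin (X - Y))\<^sup>2" 
      using p' by (simp add: k_def field_simps)
    also have "\<dots> = 4 * (sin X * cos Y) * (cos X * sin Y)" unfolding sin_add sin_diff by algebra
    also have "\<dots> = - 4 * (u c * v c) * (sin (X - Y))\<^sup>2"
      unfolding locus_c XY(1) X_Y_def[symmetric] using p' by (simp add: power2_eq_square)
    finally show ?thesis .
  qed
  moreover have "(sin (X - Y))\<^sup>2 \<noteq> 0" using p' by simp
  ultimately have kk: "k\<^sup>2 - 1 = - 4 * (u c * v c)" using mult_right_cancel by blast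
  have "k\<^sup>2 - 1 > 0" using k by (simp add: one_less_power)
  then have "1 + 2 * (2 / (k\<^sup>2 - 1) * u c * v c) = 0" using kk by (simp add: field_simps)
  moreover have "locus c = u c *\<^sub>R A + v c *\<^sub>R B" by (simp add: locus_def bary_def locus_c(1))
  ultimately show ?thesis unfolding focal_vertices_eq[OF vertices_distinct(1) d k] using uv by blast
qed

text \<open>The curve meets the line BC only where one of the two factors of \<open>u\<close>
  vanishes. At such a parameter the numerator of \<open>v\<close> reduces to a product of quantities
  of known sign and a square equal to 1.\<close>

lemma locus_on_side:
  assumes "bary A B C 0 y z \<in> range locus" "y + z = 1"
  shows "y > 0"
proof -
  obtain t where t: "bary A B C 0 y z = locus t" using assms(1) by blast
  have ut: "u t = 0" and vt: "v t = y"
    using bary_unique[OF noncollinear _ _ t[unfolded locus_def]] sum_uvw[of t] assms(2) by auto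
  have "sin (t - a) = 0 \<or> cos (t - (b + c) / 2) = 0" using ut pos(4,8) by (auto simp: u_def)
  then have "sin (t - b) * cos (t - (a + c) / 2) < 0"
  proof
    assume s: "sin (t - a) = 0"
    then have c1: "cos (t - a) * cos (t - a) = 1" using sin_cos_squared_add[of "t - a"] by (simp add: power2_eq_square)
    have e: "t - b = (t - a) - (b - a)" "t - (a + c) / 2 = (t - a) - (c - a) / 2" by (simp_all add: field_simps)
    have "sin (t - b) * cos (t - (a + c) / 2) = - (cos (t - a) * cos (t - a)) * sin (b - a) * cos ((c - a) / 2)"
      unfolding e sin_diff[of "t - a"] cos_diff[of "t - a"] s by simp
    then show ?thesis unfolding c1 using pos by simp
  next
    assume s: "cos (t - (b + c) / 2) = 0"
    then have c1: "sin (t - (b + c) / 2) * sin (t - (b + c) / 2) = 1"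
      using sin_cos_squared_add[of "t - (b + c) / 2"] by (simp add: power2_eq_square)
    have e: "t - b = (t - (b + c) / 2) + (c - b) / 2" "t - (a + c) / 2 = (t - (b + c) / 2) + (b - a) / 2"
      by (simp_all add: field_simps)
    have "sin (t - b) * cos (t - (a + c) / 2) =
        - (sin (t - (b + c) / 2) * sin (t - (b + c) / 2)) * cos ((c - b) / 2) * sin ((b - a) / 2)"
      unfolding e sin_add[of "t - (b + c) / 2"] cos_add[of "t - (b + c) / 2"] s
      by simp
    then show ?thesis unfolding c1 using pos by simp
  qed
  then have "v t > 0" unfolding v_def using pos by (intro divide_pos_pos) auto
  then show ?thesis using vt by simp
qed

section \<open>The circumcircle and its open arcs by parameter\<close>

lemma circumcircle_sphere: "circumcircle A B C = sphere Z R"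
  using circumcircle_eq[OF noncollinear] dist_center_circ_pt[OF R e] by blast

lemma sphere_param: "sphere Z R = P ` {t0..<t0 + pi}"
proof
  show "sphere Z R \<subseteq> P ` {t0..<t0 + pi}"
    using circ_pt_surj[OF R e, of Z _ t0] by (metis atLeastLessThan_iff image_eqI mem_sphere subsetI)
  show "P ` {t0..<t0 + pi} \<subseteq> sphere Z R"
    using dist_center_circ_pt[OF R e] by auto
qed

lemma P_inj: "P s = P t \<Longrightarrow> \<bar>s - t\<bar> < pi \<Longrightarrow> s = t"
  using circ_pt_eq_imp[OF R e] .

text \<open>Up to a positive factor, \<open>h\<close> is the signed distance to the line \<open>BC\<close>; its sign separates the two
  arcs between \<open>B\<close> and \<open>C\<close>.\<close>

lemma arc_side:
  obtains h :: "real^2 \<Rightarrow> real" where "continuous_on UNIV h" "\<And>t. h (P t) = sin (t - b) * sin (c - t)"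
proof
  define h where "h X = ((X$1 - Z$1) * cos (b + c) + e * (X$2 - Z$2) * sin (b + c)) / (2 * R) - cos (c - b) / 2"
    for X :: "real^2"
  show "continuous_on UNIV h" unfolding h_def using R by (intro continuous_intros) auto
  fix t
  have ee: "e * e = 1" using e by auto
  have "h (P t) = (cos (2 * t) * cos (b + c) + (e * e) * sin (2 * t) * sin (b + c)) / 2 - cos (c - b) / 2"
    unfolding h_def circ_pt_components using R by (simp add: field_simps)
  also have "\<dots> = (cos (2 * t - (b + c)) - cos (c - b)) / 2" unfolding ee cos_diff[of "2 * t"] by simp
  also have "\<dots> = sin (t - b) * sin (c - t)"
  proof -
    have "cos (2 * t - (b + c)) = cos ((t - b) - (c - t))" "cos (c - b) = cos ((t - b) + (c - t))"
      by (simp_all add: algebra_simps)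
    then show ?thesis unfolding sin_times_sin by simp
  qed
  finally show "h (P t) = sin (t - b) * sin (c - t)" .
qed

text \<open>On a connected subset of the circle without B and C the function \<open>h\<close> keeps
  its sign, so every component lies in \<open>K\<close> or in \<open>K'\<close>, and maximality of
  components gives equality. A belongs to \<open>K'\<close> through its parameter a + pi.\<close>

lemma circum_arc_eq: "circum_arc A B C = P ` {b<..<c}"
proof -
  obtain h where h: "continuous_on UNIV h" "\<And>t. h (P t) = sin (t - b) * sin (c - t)" using arc_side by metis
  let ?S = "circumcircle A B C - {B, C}"
  define K where "K = P ` {b<..<c}"
  define K' where "K' = P ` {c<..<b + pi}"
  have hK: "h X > 0" if "X \<in> K" for X
    using that bc ca ab by (auto simp: K_def h intro!: mult_pos_pos sin_gt_zero)
  have hK': "h X < 0" if X: "X \<in> K'" for X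
  proof -
    obtain t where t: "c < t" "t < b + pi" "X = P t" using X by (auto simp: K'_def)
    have "sin (t - b) > 0" "sin (t - c) > 0" using t bc by (auto intro!: sin_gt_zero)
    moreover have "sin (c - t) = - sin (t - c)" using sin_minus[of "t - c"] by simp
    ultimately show ?thesis by (simp add: t h)
  qed
  have S: "?S = K \<union> K'"
  proof -
    have "{b..<b + pi} = {b, c} \<union> {b<..<c} \<union> {c<..<b + pi}" using bc ca ab by auto
    then have "sphere Z R = {B, C} \<union> K \<union> K'" unfolding sphere_param[of b] K_def K'_def by (simp add: image_Un)
    moreover have "h B = 0" "h C = 0" by (simp_all add: h)
    then have "B \<notin> K \<union> K'" "C \<notin> K \<union> K'" using hK hK' by force+
    ultimately show ?thesis unfolding circumcircle_sphere by blast
  qed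
  have conn: "connected K" "connected K'" unfolding K_def K'_def
    by (intro connected_continuous_image continuous_on_circ_pt; simp)+
  have ne: "K \<noteq> {}" "K' \<noteq> {}" using bc ca ab by (auto simp: K_def K'_def)
  have AK': "A \<in> K'" 
  proof -
    have "A = P (a + pi)" by (simp add: circ_pt_pi)
    moreover have "a + pi \<in> {c<..<b + pi}" using ca ab by simp
    ultimately show ?thesis unfolding K'_def by blast
  qed
  have sign: "(\<forall>X\<in>T. h X > 0) \<or> (\<forall>X\<in>T. h X < 0)" if T: "connected T" "T \<subseteq> ?S" for T
  proof (rule ccontr)
    assume "\<not> ?thesis"
    then obtain X Y where "X \<in> T" "Y \<in> T" "h X \<le> 0" "h Y \<ge> 0" by (meson not_less)
    moreover have "connected (h ` T)" using T(1) h(1) by (meson connected_continuous_image continuous_on_subset subset_UNIV)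
    ultimately have "0 \<in> h ` T" by (meson connectedD_interval image_eqI)
    then obtain W where "W \<in> T" "h W = 0" by auto
    then show False using T(2) S hK hK' by force
  qed
  have comp: "T = K \<or> T = K'" if T: "T \<in> components ?S" for T
  proof -
    note Tc = in_components_connected[OF T] in_components_subset[OF T] in_components_nonempty[OF T]
    have sub: "T \<subseteq> K \<union> K'" using Tc(2) unfolding S .
    have KS: "K \<subseteq> ?S" "K' \<subseteq> ?S" unfolding S by blast+
    from sign[OF Tc(1,2)] show ?thesis
    proof
      assume "\<forall>X\<in>T. h X > 0"
      then have "T \<subseteq> K" using sub hK' by (meson Un_iff not_less_iff_gr_or_eq subsetD subsetI)
      then show ?thesis using components_maximal[OF T conn(1) KS(1)] Tc(3) by blast
    next
      assume "\<forall>X\<in>T. h X < 0"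
      then have "T \<subseteq> K'" using sub hK by (meson Un_iff not_less_iff_gr_or_eq subsetD subsetI)
      then show ?thesis using components_maximal[OF T conn(2) KS(2)] Tc(3) by blast
    qed
  qed
  have "A \<notin> K" using AK' hK hK' by force
  have Kcomp: "K \<in> components ?S"
  proof -
    obtain X where X: "X \<in> K" using ne by blast
    then obtain T where T: "T \<in> components ?S" "X \<in> T" using S Union_components[of ?S] by blast
    have "X \<notin> K'" using X hK hK' by force
    then show ?thesis using comp[OF T(1)] T by blast
  qed
  show ?thesis unfolding circum_arc_def K_def[symmetric]
  proof (rule the_equality)
    show "K \<in> components ?S \<and> A \<notin> K" using Kcomp \<open>A \<notin> K\<close> by blast
  next
    fix T assume "T \<in> components ?S \<and> A \<notin> T"
    then show "T = K" using comp AK' by blast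
  qed
qed

section \<open>The traced arc and the limits at its ends\<close>

definition arc_param where "arc_param s = locus (b + (c - b) * s)"

lemma arc_param_ends: "pathstart arc_param = locus b" "pathfinish arc_param = locus c"
  by (simp_all add: arc_param_def pathstart_def pathfinish_def)

lemma arc_param_image: "path_image arc_param = locus ` {b..c}"
proof -
  have "(\<lambda>s. b + (c - b) * s) ` {0..1} = {b..c}" using bc image_affinity_atLeastAtMost[of "c - b" b 0 1]
    by (simp add: add.commute)
  moreover have "path_image arc_param = locus ` (\<lambda>s. b + (c - b) * s) ` {0..1}"
    unfolding path_image_def arc_param_def by (simp add: image_image)
  ultimately show ?thesis by simp
qed

lemma open_arc_image_arc_param: "open_arc_image arc_param = locus ` {b<..<c}"
proof -
  have "locus t \<noteq> locus b" "locus t \<noteq> locus c" if "b < t" "t < c" for t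
    using locus_inj[of t b] locus_inj[of t c] that bc ca ab by auto
  moreover have "{b..c} = {b, c} \<union> {b<..<c}" using bc by auto
  ultimately show ?thesis unfolding open_arc_image_def arc_param_image arc_param_ends by auto
qed

text \<open>On the open arc \<open>O_star\<close> is \<open>locus\<close> composed with the inverse
  of the parametrization. That inverse is continuous on the closed arc, because \<open>P\<close> is
  continuous and injective on a compact interval, so the composition supplies the limit.\<close>

lemma O_star_tendsto:
  assumes "t0 = b \<or> t0 = c"
  shows "(O_star A B C \<longlongrightarrow> locus t0) (at (P t0) within P ` {b<..<c})"
proof -
  have inj: "inj_on P {b..c}"
  proof (rule inj_onI)
    fix s t assume "s \<in> {b..c}" "t \<in> {b..c}" "P s = P t"
    then show "s = t" using P_inj[of s t] ab ca by auto
  qed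
  define h where "h = inv_into {b..c} P"
  have hP: "h (P t) = t" if "t \<in> {b..c}" for t using inv_into_f_f[OF inj that] by (simp add: h_def)
  have "continuous_on (P ` {b..c}) h"
    by (rule continuous_on_inv[OF continuous_on_circ_pt compact_Icc]) (use hP in blast)
  then have "continuous_on (P ` {b..c}) (locus \<circ> h)"
    by (rule continuous_on_compose[OF _ continuous_on_locus])
  moreover have t0: "t0 \<in> {b..c}" using assms bc by auto
  ultimately have "((locus \<circ> h) \<longlongrightarrow> (locus \<circ> h) (P t0)) (at (P t0) within P ` {b..c})"
    unfolding continuous_on_def by blast
  then have "((locus \<circ> h) \<longlongrightarrow> locus t0) (at (P t0) within P ` {b<..<c})"
    using hP[OF t0] by (auto elim!: tendsto_within_subset)
  then show ?thesis
  proof (rule Lim_transform_within[OF _ zero_less_one])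
    fix X assume "X \<in> P ` {b<..<c}"
    then show "(locus \<circ> h) X = O_star A B C X" using hP O_star_eq_locus by auto
  qed
qed

lemma O_star_image: "O_star A B C ` P ` {b<..<c} = locus ` {b<..<c}"
  unfolding image_image using O_star_eq_locus by (intro image_cong) auto

lemma traces_arc_locus: "traces_arc (O_star A B C) (circum_arc A B C) B C (range locus) arc_param"
  unfolding traces_arc_def circum_arc_eq arc_param_ends O_star_image open_arc_image_arc_param arc_param_image
proof (intro conjI)
  have "continuous_on {0..1} arc_param" unfolding arc_param_def
    by (intro continuous_on_compose2[OF continuous_on_locus[of UNIV]] continuous_intros) auto
  moreover have "inj_on arc_param {0..1}"
  proof (rule inj_onI)
    fix x y :: real assume xy: "x \<in> {0..1}" "y \<in> {0..1}" "arc_param x = arc_param y"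
    \<comment> \<open>Parameters in [b, c] differ by at most c - b < pi, the range in which
      \<open>locus\<close> is injective.\<close>
    have "\<bar>x - y\<bar> \<le> 1" using xy by auto
    then have "(c - b) * \<bar>x - y\<bar> \<le> c - b" using bc mult_left_mono[of "\<bar>x - y\<bar>" 1 "c - b"] by simp
    moreover have "(b + (c - b) * x) - (b + (c - b) * y) = (c - b) * (x - y)" by (simp add: algebra_simps)
    then have "\<bar>(b + (c - b) * x) - (b + (c - b) * y)\<bar> = (c - b) * \<bar>x - y\<bar>"
      using bc by (simp only: abs_mult abs_of_pos diff_gt_0_iff_gt)
    ultimately have "\<bar>(b + (c - b) * x) - (b + (c - b) * y)\<bar> < pi" using ca ab by linarith
    then have "b + (c - b) * x = b + (c - b) * y" using xy(3) locus_inj unfolding arc_param_def by blast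
    then show "x = y" using bc by simp
  qed
  ultimately show "arc arc_param" by (simp add: arc_def path_def)
qed (use O_star_tendsto in auto)

text \<open>The witness is \<open>locus b\<close>, with its coordinates in the order B, C, A that
  \<open>locus_on_side\<close> uses for the next cyclic instance; this pair separates consecutive
  ellipses.\<close>

lemma locus_side_witness: "\<exists>y z. y + z = 1 \<and> y < 0 \<and> bary B C A 0 y z \<in> range locus"
proof (intro exI conjI)
  show "w b + u b = 1" using sum_uvw[of b] locus_b(1) by simp
  have "sin ((b - a) / 2) * sin ((c - b) / 2) / cos ((c - a) / 2) > 0" using pos by simp
  then show "w b < 0" unfolding locus_b(3) by simp
  have "bary B C A 0 (w b) (u b) = locus b" by (simp add: locus_def locus_b(1) bary_def add.commute)
  then show "bary B C A 0 (w b) (u b) \<in> range locus" by blast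
qed

text \<open>One period of the parameter starting at b is cut at c and at a + pi, the parameter of A
  in this window.\<close>

lemma circumcircle_arcs:
  "circumcircle A B C - {A, B, C} = P ` {b<..<c} \<union> P ` {c<..<a + pi} \<union> P ` {a + pi<..<b + pi}"
proof -
  have PA: "P (a + pi) = A" by (rule circ_pt_pi)
  define K where "K = {b<..<c} \<union> {c<..<a + pi} \<union> {a + pi<..<b + pi}"
  have "{b..<b + pi} = {b, c, a + pi} \<union> K" unfolding K_def using ab bc ca by auto
  then have "sphere Z R = {B, C, A} \<union> P ` K" unfolding sphere_param[of b] by (simp add: image_Un PA)
  moreover have "P t \<noteq> B" "P t \<noteq> C" "P t \<noteq> P (a + pi)" if "t \<in> K" for t
    using that P_inj[of t b] P_inj[of t c] P_inj[of t "a + pi"] ab bc ca unfolding K_def by force+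
  then have "A \<notin> P ` K" "B \<notin> P ` K" "C \<notin> P ` K" unfolding PA by force+
  ultimately have "circumcircle A B C - {A, B, C} = P ` K" unfolding circumcircle_sphere by blast
  then show ?thesis by (simp add: K_def image_Un)
qed

end

theorem proposition12:
  fixes A B C :: "real^2"
  assumes "\<not> collinear {A, B, C}"
  shows "\<exists>La Lb Lc ga gb gc.
    is_ellipse La \<and> is_ellipse Lb \<and> is_ellipse Lc \<and>
    La \<noteq> Lb \<and> Lb \<noteq> Lc \<and> Lc \<noteq> La \<and>
    {midpoint B C, midpoint C A, midpoint A B} \<subseteq> La \<inter> Lb \<inter> Lc \<and>
    O_star A B C ` (circumcircle A B C - {A, B, C}) =
      open_arc_image ga \<union> open_arc_image gb \<union> open_arc_image gc \<and>
    traces_arc (O_star A B C) (circum_arc A B C) B C La ga \<and>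
    traces_arc (O_star A B C) (circum_arc B C A) C A Lb gb \<and>
    traces_arc (O_star A B C) (circum_arc C A B) A B Lc gc \<and>
    (\<exists>vb \<in> focal_vertices C A B. \<exists>vc \<in> focal_vertices A B C.
       {pathstart ga, pathfinish ga} = {vb, vc}) \<and>
    (\<exists>vc \<in> focal_vertices A B C. \<exists>va \<in> focal_vertices B C A.
       {pathstart gb, pathfinish gb} = {vc, va}) \<and>
    (\<exists>va \<in> focal_vertices B C A. \<exists>vb \<in> focal_vertices C A B.
       {pathstart gc, pathfinish gc} = {va, vb})"
proof -
  obtain Z R e a b c where T: "inscribed_triangle R e a b c"
    and ABC: "A = circ_pt Z R e a" "B = circ_pt Z R e b" "C = circ_pt Z R e c"
    using inscribed_triangle_exists[OF assms] by metis
  interpret a: inscribed_triangle Z R e a b c by (rule T)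
  \<comment> \<open>Adding pi keeps the parameters increasing while naming the same vertex;
    \<open>norm\<close> below folds the shifted parameters back to A, B, C.\<close>
  interpret b: inscribed_triangle Z R e b c "a + pi"
    using T by (simp add: inscribed_triangle_def)
  interpret c: inscribed_triangle Z R e c "a + pi" "b + pi"
    using T by (simp add: inscribed_triangle_def)
  note norm = circ_pt_pi ABC[symmetric]
  have OB: "O_star B C A = O_star A B C" and OC: "O_star C A B = O_star A B C"
    using O_star_rotate by metis+
  have ne: "range a.locus \<noteq> range b.locus" "range b.locus \<noteq> range c.locus" "range c.locus \<noteq> range a.locus"
  proof -
    show "range a.locus \<noteq> range b.locus"
      using a.locus_side_witness b.locus_on_side unfolding norm by (metis less_asym)
    show "range b.locus \<noteq> range c.locus"
      using b.locus_side_witness c.locus_on_side unfolding norm by (metis less_asym)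
    show "range c.locus \<noteq> range a.locus"
      using c.locus_side_witness a.locus_on_side unfolding norm by (metis less_asym)
  qed
  have mid: "{midpoint B C, midpoint C A, midpoint A B} \<subseteq> range a.locus \<inter> range b.locus \<inter> range c.locus"
    using a.midpoints_in_locus b.midpoints_in_locus c.midpoints_in_locus unfolding norm by blast
  have image: "O_star A B C ` (circumcircle A B C - {A, B, C}) =
      open_arc_image a.arc_param \<union> open_arc_image b.arc_param \<union> open_arc_image c.arc_param"
    using a.circumcircle_arcs a.O_star_image b.O_star_image c.O_star_image
    unfolding norm OB OC a.open_arc_image_arc_param b.open_arc_image_arc_param c.open_arc_image_arc_param
    by (simp only: image_Un)
  have traces: "traces_arc (O_star A B C) (circum_arc A B C) B C (range a.locus) a.arc_param"
    "traces_arc (O_star A B C) (circum_arc B C A) C A (range b.locus) b.arc_param"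
    "traces_arc (O_star A B C) (circum_arc C A B) A B (range c.locus) c.arc_param"
    using a.traces_arc_locus b.traces_arc_locus c.traces_arc_locus unfolding norm OB OC .
  have ends: "pathstart a.arc_param \<in> focal_vertices C A B" "pathfinish a.arc_param \<in> focal_vertices A B C"
    "pathstart b.arc_param \<in> focal_vertices A B C" "pathfinish b.arc_param \<in> focal_vertices B C A"
    "pathstart c.arc_param \<in> focal_vertices B C A" "pathfinish c.arc_param \<in> focal_vertices C A B"
    using a.locus_b_focal_vertex a.locus_c_focal_vertex b.locus_b_focal_vertex b.locus_c_focal_vertex
      c.locus_b_focal_vertex c.locus_c_focal_vertex
    unfolding norm a.arc_param_ends b.arc_param_ends c.arc_param_ends .
  have vertices:
    "\<exists>vb \<in> focal_vertices C A B. \<exists>vc \<in> focal_vertices A B C. {pathstart a.arc_param, pathfinish a.arc_param} = {vb, vc}"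
    "\<exists>vc \<in> focal_vertices A B C. \<exists>va \<in> focal_vertices B C A. {pathstart b.arc_param, pathfinish b.arc_param} = {vc, va}"
    "\<exists>va \<in> focal_vertices B C A. \<exists>vb \<in> focal_vertices C A B. {pathstart c.arc_param, pathfinish c.arc_param} = {va, vb}"
    using ends by blast+
  show ?thesis
    by (rule exI[of _ "range a.locus"], rule exI[of _ "range b.locus"], rule exI[of _ "range c.locus"],
        rule exI[of _ "a.arc_param"], rule exI[of _ "b.arc_param"], rule exI[of _ "c.arc_param"])
      (intro conjI a.is_ellipse_locus b.is_ellipse_locus c.is_ellipse_locus ne mid image traces vertices)
qed

end
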